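(* Let $f\in\mathrm{LC}$ satisfy (H$_1$), (H$_3$) and (H$_2^\bullet$) there are $\alpha_1>0$ and $K\ge1$ with $\exp\big(\int_s^t\alpha(u)du\big)\le Ke^{-\alpha_1(t-s)}$ for all $s\le t$. Then there is a bounded set $B\subset\mathbb R^N$ such that for every bounded $D\subset\mathbb R^N$ there is $T(D)>0$ with $S_f(t,t-s)D\subset B$ for all $t\in\mathbb R$ and $s\ge T(D)$; hence the process $S_f$ has a bounded pullback attractor.
   Context: $\mathrm{LC}$: Borel measurable $f:\mathbb R\times\mathbb R^N\to\mathbb R^N$ such that for every compact $K$ there are $m^K,l^K\in L^1_{loc}$ with $|f(t,x)|\le m^K(t)$ and $|f(t,x)-f(t,y)|\le l^K(t)|x-y|$ for $x,y\in K$, a.e. $t$. (H$_1$): there exist $\alpha,\beta\in L^1_{loc}$ with $\beta\ge0$ such that $2\langle f(t,x),x\rangle\le\alpha(t)|x|^2+\beta(t)$ for a.e. $(t,x)\in\mathbb R^{1+N}$. (H$_3$): $\sup_{t\in\mathbb R}\int_{-r}^r\beta(s+t)ds<\infty$ for every $r>0$. Under (H$_1$) solutions of $\dot x=f(t,x)$, $x(r)=x_0$ exist on $[r,\infty)$; the process is $S_f(t,r)x_0=$ value at $t\ge r$ of that solution. A pullback attractor of a process $S$ on $\mathbb R^N$ is a family $\{\mathcal A(t)\}_{t\in\mathbb R}$ of compact sets with $S(t,s)\mathcal A(s)=\mathcal A(t)$ for $t\ge s$, $\lim_{s\to-\infty}\mathrm{dist}(S(t,s)D,\mathcal A(t))=0$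 for every bounded $D$ and $t$ (Hausdorff semi-distance), and minimal among closed families with this property; it is bounded if $\bigcup_t\mathcal A(t)$ is bounded. *)

theory Defs
  imports "HOL-Analysis.Analysis" "HOL-Probability.Probability"
begin

definition loc_integrable :: "(real \<Rightarrow> real) \<Rightarrow> bool" where
  "loc_integrable g \<longleftrightarrow> (\<forall>a b. set_integrable lborel {a..b} g)"

definition LC :: "(real \<Rightarrow> real^'n \<Rightarrow> real^'n) \<Rightarrow> bool" where
  "LC f \<longleftrightarrow>
     (\<lambda>p. f (fst p) (snd p)) \<in> borel_measurable borel \<and>
     (\<forall>K. compact K \<longrightarrow>
        (\<exists>m l. loc_integrable m \<and> loc_integrable l \<and>
           (AE t in lborel. \<forall>x\<in>K. \<forall>y\<in>K.
              norm (f t x) \<le> m t \<and> norm (f t x - f t y) \<le> l t * dist x y)))"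

definition H1 :: "(real \<Rightarrow> real^'n \<Rightarrow> real^'n) \<Rightarrow> (real \<Rightarrow> real) \<Rightarrow> (real \<Rightarrow> real) \<Rightarrow> bool" where
  "H1 f \<alpha> \<beta> \<longleftrightarrow> loc_integrable \<alpha> \<and> loc_integrable \<beta> \<and> (\<forall>t. \<beta> t \<ge> 0) \<and>
     (AE p in (lborel \<Otimes>\<^sub>M lborel).
        2 * (f (fst p) (snd p) \<bullet> snd p) \<le> \<alpha> (fst p) * (norm (snd p))\<^sup>2 + \<beta> (fst p))"

definition H3 :: "(real \<Rightarrow> real) \<Rightarrow> bool" where
  "H3 \<beta> \<longleftrightarrow> (\<forall>r>0. \<exists>C. \<forall>t. (LINT s:{-r..r}|lborel. \<beta> (s + t)) \<le> C)"

definition H2_bullet :: "(real \<Rightarrow> real) \<Rightarrow> bool" where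
  "H2_bullet \<alpha> \<longleftrightarrow> (\<exists>\<alpha>1>0. \<exists>K\<ge>1. \<forall>s t. s \<le> t \<longrightarrow>
      exp (LINT u:{s..t}|lborel. \<alpha> u) \<le> K * exp (- \<alpha>1 * (t - s)))"

definition is_solution ::
  "(real \<Rightarrow> real^'n \<Rightarrow> real^'n) \<Rightarrow> real \<Rightarrow> real \<Rightarrow> real^'n \<Rightarrow> (real \<Rightarrow> real^'n) \<Rightarrow> bool" where
  "is_solution f r T x0 x \<longleftrightarrow> r \<le> T \<and> continuous_on {r..T} x \<and>
     (\<forall>t\<in>{r..T}. set_integrable lborel {r..t} (\<lambda>s. f s (x s)) \<and>
        x t = x0 + (LINT s:{r..t}|lborel. f s (x s)))"

definition S_f :: "(real \<Rightarrow> real^'n \<Rightarrow> real^'n) \<Rightarrow> real \<Rightarrow> real \<Rightarrow> real^'n \<Rightarrow> real^'n" where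
  "S_f f t r x0 = (THE y. \<exists>x. is_solution f r t x0 x \<and> x t = y)"

text \<open>A family C pullback-attracts every bounded set (Hausdorff semi-distance tends to 0,
  written in epsilon form).\<close>
definition pullback_attracts ::
  "(real \<Rightarrow> real \<Rightarrow> 'a::metric_space \<Rightarrow> 'a) \<Rightarrow> (real \<Rightarrow> 'a set) \<Rightarrow> bool" where
  "pullback_attracts S C \<longleftrightarrow> (\<forall>D t. bounded D \<longrightarrow> (\<forall>\<epsilon>>0.
      eventually (\<lambda>s. \<forall>y\<in>S t s ` D. \<exists>z\<in>C t. dist y z < \<epsilon>) at_bot))"

definition pullback_attractor ::
  "(real \<Rightarrow> real \<Rightarrow> 'a::metric_space \<Rightarrow> 'a) \<Rightarrow> (real \<Rightarrow> 'a set) \<Rightarrow> bool" where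
  "pullback_attractor S A \<longleftrightarrow>
     (\<forall>t. compact (A t)) \<and>
     (\<forall>t s. s \<le> t \<longrightarrow> S t s ` A s = A t) \<and>
     pullback_attracts S A \<and>
     (\<forall>C. (\<forall>t. closed (C t)) \<and> pullback_attracts S C \<longrightarrow> (\<forall>t. A t \<subseteq> C t))"

end

theory Submission
  imports Defs
begin


text \<open>
  For a solution \<open>x\<close>, (H1) gives the differential inequality \<open>(|x|\<^sup>2)' \<le> \<alpha> |x|\<^sup>2 + \<beta>\<close> almost everywhere,
  and Gronwall's lemma turns it into
  \<open>|x(t)|\<^sup>2 \<le> K exp (-\<alpha>1 (t - s)) |x(s)|\<^sup>2 + K \<integral>\<^sub>s\<^sup>t \<beta>\<close>. Over a time step \<open>\<tau>\<close> with \<open>K exp (-\<alpha>1 \<tau>) = 1/2\<close>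
  this halves \<open>|x|\<^sup>2\<close> up to an additive constant, which is uniform in time by (H3); iterating yields an
  absorbing ball, and a compact absorbing set yields the pullback attractor.

  The same inequality, applied to the difference of two solutions, gives uniqueness and Lipschitz
  dependence on the initial value. Global existence follows by truncating \<open>f\<close> outside a ball larger
  than the a priori bound. Indefinite Lebesgue integrals are never differentiated: the
  product and chain rules for them are obtained by showing that the defect over a short interval
  \<open>[s, t]\<close> is at most \<open>\<epsilon> \<integral>\<^sub>s\<^sup>t g\<close> for a fixed integrable \<open>g\<close>, so that it vanishes after summation.
\<close>

section \<open>Indefinite Lebesgue integrals\<close>


text \<open>Absolute continuity with density \<open>f\<close>, in integrated form, so that no
  derivative has to exist or be computed.\<close>

definition primitive_on :: "real \<Rightarrow> real \<Rightarrow> (real \<Rightarrow> 'a::euclidean_space) \<Rightarrow> (real \<Rightarrow> 'a) \<Rightarrow> bool" where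
  "primitive_on a b F f \<longleftrightarrow> set_integrable lborel {a..b} f \<and>
     (\<forall>t\<in>{a..b}. F t = F a + (LINT s:{a..t}|lborel. f s))"

lemma set_integrable_subinterval:
  fixes f :: "real \<Rightarrow> 'a::euclidean_space"
  assumes "set_integrable lborel {a..b} f" "a \<le> c" "d \<le> b"
  shows "set_integrable lborel {c..d} f"
  by (rule set_integrable_subset[OF assms(1)]) (use assms in auto)

lemma set_lint_combine:
  fixes f :: "real \<Rightarrow> 'a::euclidean_space"
  assumes "set_integrable lborel {a..c} f" "a \<le> b" "b \<le> c"
  shows "(LINT s:{a..c}|lborel. f s) = (LINT s:{a..b}|lborel. f s) + (LINT s:{b..c}|lborel. f s)"
proof -
  have i: "set_integrable lborel {a..b} f" "set_integrable lborel {b..c} f"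
    using set_integrable_subinterval[OF assms(1)] assms by auto
  show ?thesis
    using assms i Henstock_Kurzweil_Integration.integral_combine[of a b c f]
    by (simp add: set_borel_integral_eq_integral)
qed

lemma primitive_on_integrable: "primitive_on a b F f \<Longrightarrow> set_integrable lborel {a..b} f"
  unfolding primitive_on_def by blast

lemma primitive_on_eq:
  "primitive_on a b F f \<Longrightarrow> a \<le> t \<Longrightarrow> t \<le> b \<Longrightarrow> F t = F a + (LINT s:{a..t}|lborel. f s)"
  unfolding primitive_on_def by (meson atLeastAtMost_iff)

lemma primitive_on_diff:
  assumes "primitive_on a b F f" "a \<le> s" "s \<le> t" "t \<le> b"
  shows "F t - F s = (LINT u:{s..t}|lborel. f u)"
proof -
  have "set_integrable lborel {a..t} f"
    using set_integrable_subinterval[OF primitive_on_integrable[OF assms(1)]] assms by simp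
  from set_lint_combine[OF this, of s] show ?thesis
    using primitive_on_eq[OF assms(1), of s] primitive_on_eq[OF assms(1), of t] assms(2-4) by simp
qed

lemma primitive_on_subinterval:
  assumes "primitive_on a b F f" "a \<le> c" "d \<le> b"
  shows "primitive_on c d F f"
  unfolding primitive_on_def
proof safe
  show "set_integrable lborel {c..d} f"
    using set_integrable_subinterval[OF primitive_on_integrable[OF assms(1)]] assms by simp
  fix t assume "t \<in> {c..d}"
  then show "F t = F c + (LINT s:{c..t}|lborel. f s)"
    using primitive_on_diff[OF assms(1), of c t] assms(2,3) by (simp add: algebra_simps)
qed

lemma primitive_on_continuous:
  assumes "primitive_on a b F f"
  shows "continuous_on {a..b} F"
proof -
  have i: "set_integrable lborel {a..b} f" using primitive_on_integrable[OF assms] .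
  then have "f integrable_on {a..b}" by (rule set_borel_integral_eq_integral)
  then have "continuous_on {a..b} (\<lambda>t. F a + integral {a..t} f)"
    by (intro continuous_intros indefinite_integral_continuous_1)
  moreover have "F t = F a + integral {a..t} f" if "t \<in> {a..b}" for t
  proof -
    have "set_integrable lborel {a..t} f" using set_integrable_subinterval[OF i] that by auto
    then show ?thesis using primitive_on_eq[OF assms, of t] that
      by (simp add: set_borel_integral_eq_integral)
  qed
  ultimately show ?thesis by (metis (no_types, lifting) continuous_on_eq)
qed

lemma set_lint_nonneg:
  fixes g :: "real \<Rightarrow> real"
  assumes "\<And>x. 0 \<le> g x"
  shows "0 \<le> (LINT s:A|lborel. g s)"
  unfolding set_lebesgue_integral_def using assms by (intro integral_nonneg_AE AE_I2) simp

lemma set_lint_nonneg_mono: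
  fixes g :: "real \<Rightarrow> real"
  assumes "set_integrable lborel {a..d} g" "\<And>x. 0 \<le> g x" "a \<le> b" "b \<le> c" "c \<le> d"
  shows "(LINT s:{b..c}|lborel. g s) \<le> (LINT s:{a..d}|lborel. g s)"
proof -
  have "(LINT s:{a..d}|lborel. g s) = (LINT s:{a..b}|lborel. g s) + (LINT s:{b..d}|lborel. g s)"
    using assms by (intro set_lint_combine) auto
  also have "(LINT s:{b..d}|lborel. g s) = (LINT s:{b..c}|lborel. g s) + (LINT s:{c..d}|lborel. g s)"
    using assms by (intro set_lint_combine set_integrable_subinterval[OF assms(1)]) auto
  finally show ?thesis
    using set_lint_nonneg[of g "{a..b}"] set_lint_nonneg[of g "{c..d}"] assms(2)
    by simp
qed

section \<open>Primitives from estimates on short intervals\<close>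

text \<open>Summing over a partition of mesh below \<open>d\<close> bounds the total change by
  \<open>e\<close> times the fixed integral of \<open>g\<close> over \<open>{a..b}\<close>, and
  \<open>e\<close> is arbitrary.\<close>

lemma eq_endpoints_if_small_increments:
  fixes h :: "real \<Rightarrow> 'a::real_normed_vector" and g :: "real \<Rightarrow> real"
  assumes ab: "a \<le> b" and g: "set_integrable lborel {a..b} g"
    and inc: "\<And>e. e > 0 \<Longrightarrow> \<exists>d>0. \<forall>s t. a \<le> s \<longrightarrow> s \<le> t \<longrightarrow> t \<le> b \<longrightarrow> t - s < d \<longrightarrow>
        norm (h t - h s) \<le> e * (LINT u:{s..t}|lborel. g u)"
  shows "h b = h a"
proof -
  define I where "I = (LINT u:{a..b}|lborel. g u)"
  have le: "norm (h b - h a) \<le> e * I" if e: "e > 0" for e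
  proof -
    obtain d where d: "d > 0" "\<And>s t. a \<le> s \<Longrightarrow> s \<le> t \<Longrightarrow> t \<le> b \<Longrightarrow> t - s < d \<Longrightarrow>
        norm (h t - h s) \<le> e * (LINT u:{s..t}|lborel. g u)"
      using inc[OF e] by blast
    \<comment> \<open>The mesh \<open>d/2\<close> meets the strict bound \<open>t - s < d\<close>;
      \<open>min b\<close> stops the grid at the right endpoint.\<close>
    have step: "norm (h (min b (a + of_nat k * (d/2))) - h a)
        \<le> e * (LINT u:{a..min b (a + of_nat k * (d/2))}|lborel. g u)" for k :: nat
    proof (induction k)
      case 0
      have "norm (h a - h a) \<le> e * (LINT u:{a..a}|lborel. g u)" using d ab by (intro d) auto
      then show ?case using ab by (simp add: min_def)
    next
      case (Suc k)
      define s t where "s = min b (a + of_nat k * (d/2))" and "t = min b (a + of_nat (Suc k) * (d/2))"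
      have "0 \<le> real k * (d / 2)" using d by simp
      then have st: "a \<le> s" "s \<le> t" "t \<le> b" "t - s < d"
        using d(1) ab unfolding s_def t_def of_nat_Suc distrib_right by (simp_all add: min_def)
      have "norm (h t - h a) \<le> norm (h t - h s) + norm (h s - h a)"
        using norm_triangle_ineq[of "h t - h s" "h s - h a"] by simp
      also have "\<dots> \<le> e * (LINT u:{s..t}|lborel. g u) + e * (LINT u:{a..s}|lborel. g u)"
        using d(2)[OF st] Suc by (simp add: s_def)
      also have "\<dots> = e * (LINT u:{a..t}|lborel. g u)"
        using set_lint_combine[OF set_integrable_subinterval[OF g order.refl st(3)] st(1,2)]
        by (simp add: distrib_left)
      finally show ?case unfolding t_def .
    qed
    obtain k :: nat where "real k > (b - a) / (d/2)" using reals_Archimedean2 by blast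
    then have "b < a + real k * (d/2)" using d by (simp add: field_simps)
    then show ?thesis using step[of k] by (simp add: I_def min_def)
  qed
  have "norm (h b - h a) \<le> 0"
  proof (rule ccontr)
    assume n: "\<not> ?thesis"
    \<comment> \<open>This makes \<open>e * (\<bar>I\<bar> + 1)\<close> half of the norm; the
      \<open>+ 1\<close> keeps the denominator positive when \<open>I = 0\<close>.\<close>
    define e where "e = norm (h b - h a) / (2 * (\<bar>I\<bar> + 1))"
    have e: "e > 0" using n by (simp add: e_def)
    have "norm (h b - h a) \<le> e * I" using le[OF e] .
    also have "\<dots> \<le> e * (\<bar>I\<bar> + 1)" using e by (intro mult_left_mono) auto
    also have "\<dots> = norm (h b - h a) / 2"
      by (simp add: e_def field_simps)
    finally show False using n by simp
  qed
  then show ?thesis by simp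
qed

text \<open>Criterion behind the product and chain rules: the defect \<open>F\<close> minus the
  integral of \<open>f\<close> satisfies \<open>eq_endpoints_if_small_increments\<close> on every
  \<open>{a..t}\<close>, so it is constant.\<close>

lemma primitive_onI_small_increments:
  fixes f :: "real \<Rightarrow> 'a::euclidean_space" and g :: "real \<Rightarrow> real"
  assumes f: "set_integrable lborel {a..b} f" and g: "set_integrable lborel {a..b} g"
    and inc: "\<And>e. e > 0 \<Longrightarrow> \<exists>d>0. \<forall>s t. a \<le> s \<longrightarrow> s \<le> t \<longrightarrow> t \<le> b \<longrightarrow> t - s < d \<longrightarrow>
        norm (F t - F s - (LINT u:{s..t}|lborel. f u)) \<le> e * (LINT u:{s..t}|lborel. g u)"
  shows "primitive_on a b F f"
  unfolding primitive_on_def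
proof (intro conjI f ballI)
  fix t assume t: "t \<in> {a..b}"
  define h where "h u = F u - (LINT s:{a..u}|lborel. f s)" for u
  have "h t = h a"
  proof (rule eq_endpoints_if_small_increments[where g=g])
    show "a \<le> t" "set_integrable lborel {a..t} g"
      using set_integrable_subinterval[OF g] t by auto
    fix e :: real assume "e > 0"
    then obtain d where d: "d > 0" "\<And>s t. a \<le> s \<Longrightarrow> s \<le> t \<Longrightarrow> t \<le> b \<Longrightarrow> t - s < d \<Longrightarrow>
        norm (F t - F s - (LINT u:{s..t}|lborel. f u)) \<le> e * (LINT u:{s..t}|lborel. g u)"
      using inc by blast
    have "h v - h u = F v - F u - (LINT s:{u..v}|lborel. f s)" if "a \<le> u" "u \<le> v" "v \<le> t" for u v
    proof -
      have "set_integrable lborel {a..v} f" using set_integrable_subinterval[OF f] t that by auto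
      from set_lint_combine[OF this, of u] that show ?thesis by (simp add: h_def)
    qed
    then show "\<exists>d>0. \<forall>u v. a \<le> u \<longrightarrow> u \<le> v \<longrightarrow> v \<le> t \<longrightarrow> v - u < d \<longrightarrow>
        norm (h v - h u) \<le> e * (LINT u:{u..v}|lborel. g u)"
      using d t by (intro exI[of _ d]) auto
  qed
  moreover have "(LINT s:{a..a}|lborel. f s) = 0"
  proof -
    have "set_integrable lborel {a..a} f" by (rule set_integrable_subinterval[OF f]) (use t in auto)
    then show ?thesis by (simp add: set_borel_integral_eq_integral)
  qed
  ultimately show "F t = F a + (LINT s:{a..t}|lborel. f s)"
    by (simp add: h_def algebra_simps)
qed

lemma set_integrable_inner_continuous:
  fixes f G :: "real \<Rightarrow> 'a::euclidean_space"
  assumes f: "set_integrable lborel {a..b} f" and G: "continuous_on {a..b} G"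
  shows "set_integrable lborel {a..b} (\<lambda>u. f u \<bullet> G u)"
proof -
  obtain M where M: "\<And>u. u \<in> {a..b} \<Longrightarrow> norm (G u) \<le> M"
    using compact_continuous_image[OF G] compact_imp_bounded by (force simp: bounded_iff)
  \<comment> \<open>Nothing is known about \<open>G\<close> outside \<open>{a..b}\<close>, so
    measurability goes through the cut-off functions; their inner product is the cut-off of
    \<open>f \<bullet> G\<close> because the indicator is idempotent.\<close>
  have mG: "(\<lambda>x. indicator {a..b} x *\<^sub>R G x) \<in> borel_measurable lborel"
    using borel_measurable_continuous_on_indicator[OF _ G] by simp
  have mf: "(\<lambda>x. indicator {a..b} x *\<^sub>R f x) \<in> borel_measurable lborel"
    using f unfolding set_integrable_def by (rule borel_measurable_integrable)
  have "set_integrable lborel {a..b} (\<lambda>u. M * norm (f u))"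
    using set_integrable_norm[OF f] by simp
  then show ?thesis
  proof (rule set_integrable_bound)
    have "(\<lambda>x. (indicator {a..b} x *\<^sub>R f x) \<bullet> (indicator {a..b} x *\<^sub>R G x)) \<in> borel_measurable lborel"
      using mf mG by (rule borel_measurable_inner)
    moreover have "(\<lambda>x. (indicator {a..b} x *\<^sub>R f x) \<bullet> (indicator {a..b} x *\<^sub>R G x))
        = (\<lambda>x. indicator {a..b} x *\<^sub>R (f x \<bullet> G x))"
      by (auto simp: indicator_def)
    ultimately show "set_borel_measurable lborel {a..b} (\<lambda>u. f u \<bullet> G u)"
      by (simp add: set_borel_measurable_def)
    have "norm (f u \<bullet> G u) \<le> norm (M * norm (f u))" if "u \<in> {a..b}" for u
    proof -
      have "norm (f u \<bullet> G u) \<le> norm (f u) * norm (G u)" by (simp add: Cauchy_Schwarz_ineq2)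
      also have "\<dots> \<le> norm (f u) * M" by (intro mult_left_mono M that) simp
      also have "\<dots> \<le> norm (f u) * \<bar>M\<bar>" by (intro mult_left_mono) auto
      finally show ?thesis by (simp add: abs_mult mult.commute)
    qed
    then show "AE x in lborel. x \<in> {a..b} \<longrightarrow> norm (f x \<bullet> G x) \<le> norm (M * norm (f x))"
      by (intro AE_I2) auto
  qed
qed

lemma norm_set_lint_le:
  fixes f :: "real \<Rightarrow> 'a::euclidean_space"
  assumes "set_integrable lborel {a..b} f" "set_integrable lborel {a..b} g"
    and "AE u in lborel. u \<in> {a..b} \<longrightarrow> norm (f u) \<le> g u"
  shows "norm (LINT u:{a..b}|lborel. f u) \<le> (LINT u:{a..b}|lborel. g u)"
proof -
  have "norm (LINT u:{a..b}|lborel. f u) \<le> (LINT u:{a..b}|lborel. norm (f u))"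
    using assms by (intro set_integral_norm_bound)
  also have "\<dots> \<le> (LINT u:{a..b}|lborel. g u)"
    using assms by (intro set_integral_mono_AE set_integrable_norm) auto
  finally show ?thesis .
qed


section \<open>Product and chain rules\<close>

lemma primitive_on_inner:
  fixes F G f g :: "real \<Rightarrow> 'a::euclidean_space"
  assumes F: "primitive_on a b F f" and G: "primitive_on a b G g"
  shows "primitive_on a b (\<lambda>t. F t \<bullet> G t) (\<lambda>t. f t \<bullet> G t + g t \<bullet> F t)"
proof (rule primitive_onI_small_increments)
  note cF = primitive_on_continuous[OF F] and cG = primitive_on_continuous[OF G]
  note iF = primitive_on_integrable[OF F] and iG = primitive_on_integrable[OF G]
  note ifG = set_integrable_inner_continuous[OF iF cG] and igF = set_integrable_inner_continuous[OF iG cF]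
  show "set_integrable lborel {a..b} (\<lambda>t. f t \<bullet> G t + g t \<bullet> F t)"
    by (intro set_integral_add ifG igF)
  show "set_integrable lborel {a..b} (\<lambda>t. norm (f t) + norm (g t))"
    by (intro set_integral_add set_integrable_norm iF iG)
  fix e :: real assume e: "e > 0"
  have uF: "uniformly_continuous_on {a..b} F" and uG: "uniformly_continuous_on {a..b} G"
    using compact_uniformly_continuous[OF cF compact_Icc] compact_uniformly_continuous[OF cG compact_Icc] .
  obtain d1 where d1: "d1 > 0" "\<And>s t. t \<in> {a..b} \<Longrightarrow> s \<in> {a..b} \<Longrightarrow> dist s t < d1 \<Longrightarrow> dist (F s) (F t) < e"
    using uniformly_continuous_onE[OF uF e] by metis
  obtain d2 where d2: "d2 > 0" "\<And>s t. t \<in> {a..b} \<Longrightarrow> s \<in> {a..b} \<Longrightarrow> dist s t < d2 \<Longrightarrow> dist (G s) (G t) < e"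
    using uniformly_continuous_onE[OF uG e] by metis
  have "norm (F t \<bullet> G t - F s \<bullet> G s - (LINT u:{s..t}|lborel. f u \<bullet> G u + g u \<bullet> F u))
      \<le> e * (LINT u:{s..t}|lborel. norm (f u) + norm (g u))"
    if st: "a \<le> s" "s \<le> t" "t \<le> b" and d: "t - s < min d1 d2" for s t
  proof -
    have sub: "set_integrable lborel {s..t} h" if "set_integrable lborel {a..b} h" for h :: "real \<Rightarrow> 'b::euclidean_space"
      using set_integrable_subinterval[OF that] st by blast
    note jF = sub[OF iF] and jG = sub[OF iG]
    have jfc: "set_integrable lborel {s..t} (\<lambda>u. f u \<bullet> c)" "set_integrable lborel {s..t} (\<lambda>u. g u \<bullet> c)" for c
      by (intro set_integrable_inner_continuous jF jG continuous_intros)+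
    have lc: "(LINT u:{s..t}|lborel. h u \<bullet> c) = (LINT u:{s..t}|lborel. h u) \<bullet> c"
      if "set_integrable lborel {s..t} h" for h :: "real \<Rightarrow> 'a" and c
    proof -
      have "(LINT u|lborel. (indicator {s..t} u *\<^sub>R h u) \<bullet> c) = (LINT u|lborel. indicator {s..t} u *\<^sub>R h u) \<bullet> c"
        using that unfolding set_integrable_def by (intro integral_inner_left) auto
      then show ?thesis unfolding set_lebesgue_integral_def by simp
    qed
    have "F t \<bullet> G t - F s \<bullet> G s = (F t - F s) \<bullet> G s + (G t - G s) \<bullet> F t"
      by (simp add: inner_diff_left inner_diff_right inner_commute)
    also have "\<dots> = (LINT u:{s..t}|lborel. f u \<bullet> G s) + (LINT u:{s..t}|lborel. g u \<bullet> F t)"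
      using primitive_on_diff[OF F st] primitive_on_diff[OF G st] lc[OF jF] lc[OF jG] by simp
    also have "\<dots> = (LINT u:{s..t}|lborel. f u \<bullet> G s + g u \<bullet> F t)"
      by (simp add: set_integral_add(2) jfc)
    finally have "F t \<bullet> G t - F s \<bullet> G s - (LINT u:{s..t}|lborel. f u \<bullet> G u + g u \<bullet> F u) =
        (LINT u:{s..t}|lborel. (f u \<bullet> G s + g u \<bullet> F t) - (f u \<bullet> G u + g u \<bullet> F u))"
      using set_integral_diff(2)[OF set_integral_add(1)[OF jfc(1) jfc(2)] set_integral_add(1)[OF sub[OF ifG] sub[OF igF]]]
      by simp
    also have "norm \<dots> \<le> (LINT u:{s..t}|lborel. e * (norm (f u) + norm (g u)))"
    proof (rule norm_set_lint_le)
      show "set_integrable lborel {s..t} (\<lambda>u. (f u \<bullet> G s + g u \<bullet> F t) - (f u \<bullet> G u + g u \<bullet> F u))"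
        by (intro set_integral_diff set_integral_add jfc sub[OF ifG] sub[OF igF])
      show "set_integrable lborel {s..t} (\<lambda>u. e * (norm (f u) + norm (g u)))"
        by (intro set_integrable_mult_right set_integral_add set_integrable_norm jF jG)
      have "norm ((f u \<bullet> G s + g u \<bullet> F t) - (f u \<bullet> G u + g u \<bullet> F u)) \<le> e * (norm (f u) + norm (g u))"
        if u: "u \<in> {s..t}" for u
      proof -
        have "(f u \<bullet> G s + g u \<bullet> F t) - (f u \<bullet> G u + g u \<bullet> F u) = f u \<bullet> (G s - G u) + g u \<bullet> (F t - F u)"
          by (simp add: inner_diff_right)
        also have "norm \<dots> \<le> norm (f u) * norm (G s - G u) + norm (g u) * norm (F t - F u)"
          by (rule order_trans[OF norm_triangle_ineq]) (simp add: add_mono Cauchy_Schwarz_ineq2)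
        also have "\<dots> \<le> norm (f u) * e + norm (g u) * e"
        proof (intro add_mono mult_left_mono)
          show "norm (G s - G u) \<le> e" using d2(2)[of s u] u d st by (simp add: dist_norm dist_real_def norm_minus_commute)
          show "norm (F t - F u) \<le> e" using d1(2)[of t u] u d st by (simp add: dist_norm dist_real_def norm_minus_commute)
        qed auto
        finally show ?thesis by (simp add: algebra_simps)
      qed
      then show "AE u in lborel. u \<in> {s..t} \<longrightarrow> norm ((f u \<bullet> G s + g u \<bullet> F t) - (f u \<bullet> G u + g u \<bullet> F u)) \<le> e * (norm (f u) + norm (g u))"
        by (intro AE_I2) auto
    qed
    finally show ?thesis by simp
  qed
  then show "\<exists>d>0. \<forall>s t. a \<le> s \<longrightarrow> s \<le> t \<longrightarrow> t \<le> b \<longrightarrow> t - s < d \<longrightarrow>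
      norm (F t \<bullet> G t - F s \<bullet> G s - (LINT u:{s..t}|lborel. f u \<bullet> G u + g u \<bullet> F u))
      \<le> e * (LINT u:{s..t}|lborel. norm (f u) + norm (g u))"
    using d1(1) d2(1) by (intro exI[of _ "min d1 d2"]) auto
qed

text \<open>By convexity, the tangents at \<open>x\<close> and at \<open>y\<close> place the
  remainder between 0 and \<open>(exp y - exp x) * (y - x)\<close>. The first factor is later made
  small by uniform continuity.\<close>

lemma exp_remainder_le:
  fixes x y :: real
  shows "\<bar>exp y - exp x - exp x * (y - x)\<bar> \<le> \<bar>exp y - exp x\<bar> * \<bar>y - x\<bar>"
proof -
  have 1: "exp x * (y - x) \<le> exp y - exp x"
  proof -
    have "exp x * (1 + (y - x)) \<le> exp x * exp (y - x)" by (intro mult_left_mono exp_ge_add_one_self) auto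
    then show ?thesis by (simp add: exp_diff algebra_simps)
  qed
  have 2: "exp y - exp x \<le> exp y * (y - x)"
  proof -
    have "exp y * (1 + (x - y)) \<le> exp y * exp (x - y)" by (intro mult_left_mono exp_ge_add_one_self) auto
    then show ?thesis by (simp add: exp_diff algebra_simps)
  qed
  have "exp y - exp x - exp x * (y - x) \<le> (exp y - exp x) * (y - x)"
    using 2 by (simp add: algebra_simps)
  then show ?thesis using 1 by (simp flip: abs_mult)
qed

text \<open>Two errors arise, each at most \<open>e/2\<close> times the integral of
  \<open>\<bar>f\<bar>\<close>: linearising \<open>exp\<close> at \<open>F s\<close>, and replacing
  \<open>exp (F s)\<close> by \<open>exp (F u)\<close> under the integral.\<close>

lemma primitive_on_exp:
  fixes F f :: "real \<Rightarrow> real"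
  assumes F: "primitive_on a b F f"
  shows "primitive_on a b (\<lambda>t. exp (F t)) (\<lambda>t. f t * exp (F t))"
proof (rule primitive_onI_small_increments)
  note cF = primitive_on_continuous[OF F] and iF = primitive_on_integrable[OF F]
  have cE: "continuous_on {a..b} (\<lambda>t. exp (F t))" by (intro continuous_intros cF)
  have ifE: "set_integrable lborel {a..b} (\<lambda>t. f t * exp (F t))"
    using set_integrable_inner_continuous[OF iF cE] by simp
  then show "set_integrable lborel {a..b} (\<lambda>t. f t * exp (F t))" .
  show "set_integrable lborel {a..b} (\<lambda>t. norm (f t))" by (rule set_integrable_norm[OF iF])
  fix e :: real assume e: "e > 0"
  have uE: "uniformly_continuous_on {a..b} (\<lambda>t. exp (F t))"
    using compact_uniformly_continuous[OF cE compact_Icc] .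
  obtain d where d: "d > 0" "\<And>s t. t \<in> {a..b} \<Longrightarrow> s \<in> {a..b} \<Longrightarrow> dist s t < d \<Longrightarrow> dist (exp (F s)) (exp (F t)) < e/2"
    using uniformly_continuous_onE[OF uE half_gt_zero[OF e]] by metis
  have "norm (exp (F t) - exp (F s) - (LINT u:{s..t}|lborel. f u * exp (F u))) \<le> e * (LINT u:{s..t}|lborel. norm (f u))"
    if st: "a \<le> s" "s \<le> t" "t \<le> b" and lt: "t - s < d" for s t
  proof -
    define I where "I = (LINT u:{s..t}|lborel. norm (f u))"
    have jF: "set_integrable lborel {s..t} f" and jfE: "set_integrable lborel {s..t} (\<lambda>t. f t * exp (F t))"
      using set_integrable_subinterval[OF iF] set_integrable_subinterval[OF ifE] st by blast+
    have small: "\<bar>exp (F s) - exp (F u)\<bar> \<le> e/2" if "u \<in> {s..t}" for u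
      using d(2)[of s u] that st lt by (simp add: dist_real_def abs_minus_commute)
    have dF: "F t - F s = (LINT u:{s..t}|lborel. f u)" using primitive_on_diff[OF F st] .
    then have FI: "\<bar>F t - F s\<bar> \<le> I"
      unfolding I_def using set_integral_norm_bound[OF jF] by simp
    have "\<bar>exp (F t) - exp (F s) - exp (F s) * (F t - F s)\<bar> \<le> \<bar>exp (F t) - exp (F s)\<bar> * \<bar>F t - F s\<bar>"
      by (rule exp_remainder_le)
    also have "\<dots> \<le> (e/2) * I" using small[of t] st FI e by (intro mult_mono) (auto simp: abs_minus_commute)
    finally have A: "\<bar>exp (F t) - exp (F s) - exp (F s) * (F t - F s)\<bar> \<le> (e/2) * I" .
    have "exp (F s) * (F t - F s) - (LINT u:{s..t}|lborel. f u * exp (F u)) = (LINT u:{s..t}|lborel. exp (F s) * f u - f u * exp (F u))"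
      unfolding dF using jF jfE by (simp add: set_integral_diff(2))
    also have "\<bar>\<dots>\<bar> \<le> (LINT u:{s..t}|lborel. (e/2) * norm (f u))"
      unfolding real_norm_def[symmetric]
    proof (rule norm_set_lint_le)
      show "set_integrable lborel {s..t} (\<lambda>u. exp (F s) * f u - f u * exp (F u))"
        by (intro set_integral_diff set_integrable_mult_right jF jfE)
      show "set_integrable lborel {s..t} (\<lambda>u. (e/2) * norm (f u))"
        by (intro set_integrable_mult_right set_integrable_norm jF)
      have "norm (exp (F s) * f u - f u * exp (F u)) \<le> (e/2) * norm (f u)" if "u \<in> {s..t}" for u
      proof -
        have "exp (F s) * f u - f u * exp (F u) = (exp (F s) - exp (F u)) * f u" by (simp add: algebra_simps)
        then show ?thesis using mult_right_mono[OF small[OF that], of "\<bar>f u\<bar>"] by (simp add: abs_mult)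
      qed
      then show "AE u in lborel. u \<in> {s..t} \<longrightarrow> norm (exp (F s) * f u - f u * exp (F u)) \<le> (e/2) * norm (f u)"
        by (intro AE_I2) auto
    qed
    finally have B: "\<bar>exp (F s) * (F t - F s) - (LINT u:{s..t}|lborel. f u * exp (F u))\<bar> \<le> (e/2) * I"
      by (simp add: I_def)
    from A B have "\<bar>exp (F t) - exp (F s) - (LINT u:{s..t}|lborel. f u * exp (F u))\<bar> \<le> (e/2) * I + (e/2) * I"
      by linarith
    then show ?thesis by (simp add: I_def)
  qed
  then show "\<exists>d>0. \<forall>s t. a \<le> s \<longrightarrow> s \<le> t \<longrightarrow> t \<le> b \<longrightarrow> t - s < d \<longrightarrow>
      norm (exp (F t) - exp (F s) - (LINT u:{s..t}|lborel. f u * exp (F u))) \<le> e * (LINT u:{s..t}|lborel. norm (f u))"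
    using d(1) by (intro exI[of _ d]) auto
qed

lemma primitive_on_lint:
  fixes f :: "real \<Rightarrow> 'a::euclidean_space"
  assumes "set_integrable lborel {a..b} f"
  shows "primitive_on a b (\<lambda>t. c + (LINT s:{a..t}|lborel. f s)) f"
proof (rule primitive_onI_small_increments[OF assms assms[THEN set_integrable_norm]])
  have "c + (LINT u:{a..t}|lborel. f u) - (c + (LINT u:{a..s}|lborel. f u)) - (LINT u:{s..t}|lborel. f u) = 0"
    if "a \<le> s" "s \<le> t" "t \<le> b" for s t
    using set_lint_combine[OF set_integrable_subinterval[OF assms order.refl that(3)] that(1,2)] by simp
  moreover have "0 \<le> (LINT u:A|lborel. norm (f u))" for A by (rule set_lint_nonneg) simp
  ultimately show "\<exists>d>0. \<forall>s t. a \<le> s \<longrightarrow> s \<le> t \<longrightarrow> t \<le> b \<longrightarrow> t - s < d \<longrightarrow>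
     norm (c + (LINT u:{a..t}|lborel. f u) - (c + (LINT u:{a..s}|lborel. f u)) - (LINT u:{s..t}|lborel. f u))
       \<le> e * (LINT u:{s..t}|lborel. norm (f u))" if "e > 0" for e
    using that by (intro exI[of _ 1]) simp
qed

section \<open>Gronwall's inequality\<close>

text \<open>With the integrating factor \<open>E = exp (- A)\<close>, the density of
  \<open>v * E\<close> is \<open>(w - \<alpha> * v) * E\<close>, at most \<open>\<beta> * E\<close>
  almost everywhere; integrate and multiply by \<open>exp (A b)\<close>. The constant
  \<open>K\<close> removes the weight from the forcing term, leaving the plain integral of
  \<open>\<beta>\<close> that (H3) controls.\<close>

lemma gronwall_primitive:
  fixes v w \<alpha> \<beta> :: "real \<Rightarrow> real"
  assumes ab: "a \<le> b" and v: "primitive_on a b v w"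
    and \<alpha>: "set_integrable lborel {a..b} \<alpha>" and \<beta>: "set_integrable lborel {a..b} \<beta>" "\<And>t. 0 \<le> \<beta> t"
    and ineq: "AE t in lborel. t \<in> {a..b} \<longrightarrow> w t \<le> \<alpha> t * v t + \<beta> t"
    and K: "\<And>u. u \<in> {a..b} \<Longrightarrow> exp (LINT s:{u..b}|lborel. \<alpha> s) \<le> K"
  shows "v b \<le> exp (LINT s:{a..b}|lborel. \<alpha> s) * v a + K * (LINT s:{a..b}|lborel. \<beta> s)"
proof -
  define A where "A t = (LINT s:{a..t}|lborel. \<alpha> s)" for t
  have pA: "primitive_on a b A \<alpha>"
    using primitive_on_lint[OF \<alpha>, of 0] by (simp add: A_def[abs_def])
  define E where "E t = exp (- A t)" for t
  have A0: "A a = 0" using primitive_on_eq[OF pA order.refl ab] by (simp add: A_def)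
  have "set_integrable lborel {a..b} (\<lambda>t. - \<alpha> t)"
    using set_integrable_mult_right[of "-1" lborel "{a..b}" \<alpha>] \<alpha> by simp
  from primitive_on_lint[OF this, of 0] have "primitive_on a b (\<lambda>t. - A t) (\<lambda>t. - \<alpha> t)"
    by (simp add: A_def[abs_def] set_lebesgue_integral_def)
  from primitive_on_exp[OF this] have pE: "primitive_on a b E (\<lambda>t. - \<alpha> t * E t)"
    by (simp add: E_def[abs_def])
  from primitive_on_inner[OF v pE] have pvE: "primitive_on a b (\<lambda>t. v t * E t) (\<lambda>t. w t * E t - \<alpha> t * E t * v t)"
    by simp
  note cE = primitive_on_continuous[OF pE]
  have iE: "set_integrable lborel {a..b} (\<lambda>t. \<beta> t * E t)"
    using set_integrable_inner_continuous[OF \<beta>(1) cE] by simp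
  have "v b * E b - v a * E a = (LINT t:{a..b}|lborel. w t * E t - \<alpha> t * E t * v t)"
    using primitive_on_diff[OF pvE order.refl ab order.refl] .
  also have "\<dots> \<le> (LINT t:{a..b}|lborel. \<beta> t * E t)"
  proof (rule set_integral_mono_AE[OF primitive_on_integrable[OF pvE] iE])
    show "AE t in lborel. t \<in> {a..b} \<longrightarrow> w t * E t - \<alpha> t * E t * v t \<le> \<beta> t * E t"
      using ineq
    proof eventually_elim
      case (elim t)
      show ?case
      proof
        assume "t \<in> {a..b}"
        with elim have "w t * E t \<le> (\<alpha> t * v t + \<beta> t) * E t" by (intro mult_right_mono) (auto simp: E_def)
        then show "w t * E t - \<alpha> t * E t * v t \<le> \<beta> t * E t" by (simp add: algebra_simps)
      qed
    qed
  qed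
  finally have "exp (A b) * (v b * E b - v a * E a) \<le> exp (A b) * (LINT t:{a..b}|lborel. \<beta> t * E t)"
    by (intro mult_left_mono) auto
  also have "\<dots> = (LINT t:{a..b}|lborel. exp (A b) * (\<beta> t * E t))" by simp
  \<comment> \<open>\<open>exp (A b) * E t\<close> is the exponential of the integral of
    \<open>\<alpha>\<close> over the tail \<open>{t..b}\<close>, which \<open>K\<close>
    bounds.\<close>
  also have "\<dots> \<le> (LINT t:{a..b}|lborel. K * \<beta> t)"
  proof (rule set_integral_mono)
    show "set_integrable lborel {a..b} (\<lambda>t. exp (A b) * (\<beta> t * E t))" using iE by simp
    show "set_integrable lborel {a..b} (\<lambda>t. K * \<beta> t)" using \<beta> by simp
    fix t assume t: "t \<in> {a..b}"
    have "exp (A b) * E t = exp (LINT s:{t..b}|lborel. \<alpha> s)"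
      using primitive_on_diff[OF pA, of t b] t by (simp add: E_def flip: exp_add)
    then have "exp (A b) * E t \<le> K" using K[OF t] by simp
    from mult_right_mono[OF this \<beta>(2)[of t]] show "exp (A b) * (\<beta> t * E t) \<le> K * \<beta> t"
      by (simp add: mult_ac)
  qed
  also have "exp (A b) * (v b * E b - v a * E a) = v b - exp (A b) * v a"
    by (simp add: E_def A0 exp_minus field_simps)
  finally show ?thesis by (simp add: A_def)
qed


section \<open>Globally Lipschitz right-hand sides\<close>

text \<open>Continuity of \<open>x\<close> on the whole line makes
  \<open>s \<mapsto> (s, x s)\<close> Borel, so joint measurability of \<open>g\<close> passes to
  the composition; \<open>m\<close> dominates it.\<close>

lemma set_integrable_superposition:
  fixes g :: "real \<Rightarrow> 'a::euclidean_space \<Rightarrow> 'a"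
  assumes g: "(\<lambda>p. g (fst p) (snd p)) \<in> borel_measurable borel"
    and m: "set_integrable lborel {a..b} m"
    and bound: "AE t in lborel. t \<in> {a..b} \<longrightarrow> norm (g t (x t)) \<le> m t"
    and x: "continuous_on UNIV x"
  shows "set_integrable lborel {a..b} (\<lambda>s. g s (x s))"
proof (rule set_integrable_bound[OF m])
  have "(\<lambda>s. (s, x s)) \<in> borel_measurable borel"
    using borel_measurable_continuous_onI[OF x] by (intro borel_measurable_Pair) auto
  from measurable_compose[OF this g] have "(\<lambda>s. g s (x s)) \<in> borel_measurable borel" by simp
  then show "set_borel_measurable lborel {a..b} (\<lambda>s. g s (x s))"
    unfolding set_borel_measurable_def by (intro borel_measurable_scaleR borel_measurable_indicator) auto
  show "AE t in lborel. t \<in> {a..b} \<longrightarrow> norm (g t (x t)) \<le> norm (m t)"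
    using bound by eventually_elim auto
qed

text \<open>Banach's fixed point theorem applies to the unknown rescaled by
  \<open>exp (-2 \<integral> l)\<close>, in which the integral operator contracts by the factor 1/2 on the whole interval.\<close>

lemma picard_lindeloef_L1:
  fixes g :: "real \<Rightarrow> 'a::euclidean_space \<Rightarrow> 'a" and m l :: "real \<Rightarrow> real"
  assumes rT: "r \<le> T" and g: "(\<lambda>p. g (fst p) (snd p)) \<in> borel_measurable borel"
    and m: "set_integrable lborel {r..T} m" and l: "set_integrable lborel {r..T} l"
    and bound: "AE t in lborel. \<forall>x y. norm (g t x) \<le> m t \<and> norm (g t x - g t y) \<le> l t * dist x y"
  shows "\<exists>x. primitive_on r T x (\<lambda>s. g s (x s)) \<and> x r = x0"
proof -
  \<comment> \<open>The factor 2 makes \<open>2 * \<bar>l\<bar> * exp L\<close> the density of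
    \<open>exp L\<close>; the Lipschitz estimate produces half of it, whence the contraction factor
    1/2.\<close>
  define L where "L t = 2 * (LINT s:{r..t}|lborel. \<bar>l s\<bar>)" for t
  \<comment> \<open>Clamping time to \<open>{r..T}\<close> extends functions on the interval to
    bounded continuous functions on the line, the complete space used below.\<close>
  define \<tau> where "\<tau> t = max r (min T t)" for t
  have \<tau>: "r \<le> \<tau> t" "\<tau> t \<le> T" for t using rT by (auto simp: \<tau>_def)
  have \<tau>_id: "\<tau> t = t" if "t \<in> {r..T}" for t using that by (auto simp: \<tau>_def)
  have cont_\<tau>: "continuous_on UNIV \<tau>" unfolding \<tau>_def[abs_def] by (intro continuous_intros)
  have il: "set_integrable lborel {r..T} (\<lambda>s. 2 * \<bar>l s\<bar>)" using l by (simp add: set_integrable_abs)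
  from primitive_on_lint[OF il, of 0] have pL: "primitive_on r T L (\<lambda>s. 2 * \<bar>l s\<bar>)"
    by (simp add: L_def[abs_def])
  have compose: "continuous_on UNIV (\<lambda>t. h (\<tau> t))" if "continuous_on {r..T} h" for h :: "real \<Rightarrow> 'b::topological_space"
    by (rule continuous_on_compose2[OF that cont_\<tau>]) (use \<tau> in auto)
  \<comment> \<open>\<open>X y\<close> undoes the rescaling of the unknown \<open>y\<close>;
    \<open>\<Psi>\<close> below is the integral operator followed by the rescaling.\<close>
  define X where "X y s = exp (L (\<tau> s)) *\<^sub>R apply_bcontfun y s" for y :: "real \<Rightarrow>\<^sub>C 'a" and s
  have contX: "continuous_on UNIV (X y)" for y
    unfolding X_def[abs_def]
    by (intro continuous_intros compose primitive_on_continuous[OF pL] continuous_on_apply_bcontfun)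
  have iX: "set_integrable lborel {r..T} (\<lambda>s. g s (X y s))" for y
    by (rule set_integrable_superposition[OF g m _ contX]) (use bound in eventually_elim, auto)
  define Z where "Z y t = x0 + (LINT s:{r..t}|lborel. g s (X y s))" for y t
  have pZ: "primitive_on r T (Z y) (\<lambda>s. g s (X y s))" for y
    unfolding Z_def[abs_def] by (rule primitive_on_lint[OF iX])
  define \<Psi> where "\<Psi> y t = exp (- L (\<tau> t)) *\<^sub>R Z y (\<tau> t)" for y t
  have bc: "\<Psi> y \<in> bcontfun" for y
  proof -
    have c: "continuous_on {r..T} (\<lambda>t. exp (- L t) *\<^sub>R Z y t)"
      by (intro continuous_intros primitive_on_continuous[OF pL] primitive_on_continuous[OF pZ])
    then have "bounded ((\<lambda>t. exp (- L t) *\<^sub>R Z y t) ` {r..T})"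
      by (intro compact_imp_bounded compact_continuous_image) auto
    moreover have "range (\<Psi> y) \<subseteq> (\<lambda>t. exp (- L t) *\<^sub>R Z y t) ` {r..T}"
      using \<tau> by (auto simp: \<Psi>_def)
    ultimately show ?thesis
      using compose[OF c] bounded_subset by (auto simp: bcontfun_def \<Psi>_def[abs_def])
  qed
  define \<Phi> where "\<Phi> y = Bcontfun (\<Psi> y)" for y
  have \<Phi>: "apply_bcontfun (\<Phi> y) = \<Psi> y" for y
    unfolding \<Phi>_def by (rule Bcontfun_inverse[OF bc])
  have "dist (\<Phi> y) (\<Phi> z) \<le> (1/2) * dist y z" for y z
  proof (rule dist_bound)
    fix t
    define u where "u = \<tau> t"
    have u: "r \<le> u" "u \<le> T" using \<tau> by (auto simp: u_def)
    note pE = primitive_on_exp[OF pL]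
    have iE: "set_integrable lborel {r..u} (\<lambda>s. 2 * \<bar>l s\<bar> * exp (L s))"
      using set_integrable_subinterval[OF primitive_on_integrable[OF pE] order.refl u(2)] .
    have iyz: "set_integrable lborel {r..u} (\<lambda>s. g s (X y s))" "set_integrable lborel {r..u} (\<lambda>s. g s (X z s))"
      using set_integrable_subinterval[OF iX order.refl u(2)] by auto
    have "norm (Z y u - Z z u) = norm (LINT s:{r..u}|lborel. g s (X y s) - g s (X z s))"
      using set_integral_diff(2)[OF iyz] by (simp add: Z_def)
    also have "\<dots> \<le> (LINT s:{r..u}|lborel. (dist y z / 2) * (2 * \<bar>l s\<bar> * exp (L s)))"
    proof (rule norm_set_lint_le)
      show "set_integrable lborel {r..u} (\<lambda>s. g s (X y s) - g s (X z s))"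
        by (rule set_integral_diff(1)[OF iyz])
      show "set_integrable lborel {r..u} (\<lambda>s. (dist y z / 2) * (2 * \<bar>l s\<bar> * exp (L s)))"
        by (rule set_integrable_mult_right[OF iE])
      show "AE s in lborel. s \<in> {r..u} \<longrightarrow>
          norm (g s (X y s) - g s (X z s)) \<le> (dist y z / 2) * (2 * \<bar>l s\<bar> * exp (L s))"
        using bound
      proof eventually_elim
        case (elim s)
        show ?case
        proof
          assume "s \<in> {r..u}"
          then have s: "\<tau> s = s" using u by (intro \<tau>_id) auto
          have "dist (X y s) (X z s) = exp (L s) * dist (apply_bcontfun y s) (apply_bcontfun z s)"
            by (simp add: X_def s dist_norm flip: scaleR_diff_right)
          also have "\<dots> \<le> exp (L s) * dist y z" by (intro mult_left_mono dist_bounded) auto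
          finally have d: "dist (X y s) (X z s) \<le> exp (L s) * dist y z" .
          have "norm (g s (X y s) - g s (X z s)) \<le> l s * dist (X y s) (X z s)" using elim by blast
          also have "\<dots> \<le> \<bar>l s\<bar> * (exp (L s) * dist y z)"
            using d by (intro mult_mono) auto
          finally show "norm (g s (X y s) - g s (X z s)) \<le> (dist y z / 2) * (2 * \<bar>l s\<bar> * exp (L s))"
            by (simp add: mult_ac)
        qed
      qed
    qed
    also have "\<dots> = (dist y z / 2) * (exp (L u) - exp (L r))"
      by (subst set_integral_mult_right) (simp only: primitive_on_diff[OF pE order.refl u])
    also have "\<dots> \<le> (dist y z / 2) * exp (L u)"
      by (intro mult_left_mono) auto
    finally have "exp (- L u) * norm (Z y u - Z z u) \<le> exp (- L u) * ((dist y z / 2) * exp (L u))"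
      by (intro mult_left_mono) auto
    also have "\<dots> = (1/2) * dist y z" by (simp add: exp_minus)
    finally show "dist (apply_bcontfun (\<Phi> y) t) (apply_bcontfun (\<Phi> z) t) \<le> (1/2) * dist y z"
      by (simp add: \<Phi> \<Psi>_def u_def dist_norm flip: scaleR_diff_right)
  qed
  then have "\<exists>!y. \<Phi> y = y"
    by (intro banach_fix_type[where c="1/2"]) auto
  then obtain y where y: "\<Phi> y = y" by blast
  \<comment> \<open>On the interval the clamp is the identity and the exponential factors cancel, so
    the fixed point equation becomes the integral equation.\<close>
  have XZ: "X y t = Z y t" if "t \<in> {r..T}" for t
  proof -
    have "apply_bcontfun y t = exp (- L t) *\<^sub>R Z y t"
      using \<Phi>[of y] y \<tau>_id[OF that] by (simp add: \<Psi>_def)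
    then show ?thesis by (simp add: X_def \<tau>_id[OF that] exp_minus)
  qed
  have "X y r = x0"
    using XZ[of r] rT set_borel_integral_eq_integral(2)[OF set_integrable_subinterval[OF iX[of y], of r r]]
    by (simp add: Z_def)
  moreover have "primitive_on r T (X y) (\<lambda>s. g s (X y s))"
    unfolding primitive_on_def
    using XZ \<open>X y r = x0\<close> iX[of y] by (simp add: Z_def)
  ultimately show ?thesis by blast
qed


section \<open>Pullback attractors from compact absorbing sets\<close>

text \<open>The attractor is \<open>A t = (\<Inter>s\<le>t - T0. S t s ` B)\<close>, where \<open>T0\<close> is a time after which the compact
  absorbing set \<open>B\<close> absorbs itself; the intersection is directed because \<open>S t s' ` B \<subseteq> S t s ` B\<close>
  whenever \<open>s' \<le> s - T0\<close>.\<close>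

lemma bounded_pullback_attractor_exists:
  fixes S :: "real \<Rightarrow> real \<Rightarrow> 'a::heine_borel \<Rightarrow> 'a" and B :: "'a set"
  assumes cocycle: "\<And>s u t x. s \<le> u \<Longrightarrow> u \<le> t \<Longrightarrow> S t u (S u s x) = S t s x"
    and cont: "\<And>s t. s \<le> t \<Longrightarrow> continuous_on UNIV (S t s)"
    and B: "compact B"
    and absorb: "\<And>D. bounded D \<Longrightarrow> \<exists>T>0. \<forall>t s. s \<ge> T \<longrightarrow> S t (t - s) ` D \<subseteq> B"
  shows "\<exists>A. pullback_attractor S A \<and> bounded (\<Union>t. A t)"
proof -
  obtain T0 where T0: "T0 > 0" and T0B: "\<And>t s. s \<ge> T0 \<Longrightarrow> S t (t - s) ` B \<subseteq> B"
    using absorb[OF compact_imp_bounded[OF B]] by blast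
  have inB: "S t s b \<in> B" if "b \<in> B" "s \<le> t - T0" for t s b
    using T0B[of "t - s" t] that by auto
  define A where "A t = (\<Inter>s\<in>{..t - T0}. S t s ` B)" for t
  \<comment> \<open>A sequence of start times tending to minus infinity; \<open>Suc n\<close> keeps
    each of them at least \<open>T0\<close> before \<open>t\<close>.\<close>
  define F where "F t n = S t (t - real (Suc n) * T0) ` B" for t n
  have lt: "t - real (Suc n) * T0 \<le> t" "t - real (Suc n) * T0 \<le> t - T0" for t n
    using T0 by auto
  have compF: "compact (F t n)" for t n
    unfolding F_def by (rule compact_continuous_image[OF continuous_on_subset[OF cont[OF lt(1)]] B]) simp
  have shrink: "S t s' ` B \<subseteq> S t s ` B" if "s' \<le> s - T0" "s \<le> t" for t s s'
  proof
    fix x assume "x \<in> S t s' ` B"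
    then obtain b where b: "b \<in> B" "x = S t s' b" by blast
    then have "x = S t s (S s s' b)" using cocycle[of s' s t b] that T0 by simp
    then show "x \<in> S t s ` B" using inB[OF b(1), of s' s] that by blast
  qed
  have decF: "F t n \<subseteq> F t m" if "m \<le> n" for t m n
  proof (cases "m = n")
    case False
    with that have "real m + 1 \<le> real n" by simp
    then have "(real m + 1) * T0 \<le> real n * T0" using T0 by (intro mult_right_mono) auto
    then show ?thesis unfolding F_def using T0
      by (intro shrink) (simp_all add: algebra_simps)
  qed simp
  have A_F: "A t = (\<Inter>n. F t n)" for t
  proof
    show "A t \<subseteq> (\<Inter>n. F t n)" using lt by (auto simp: A_def F_def)
    show "(\<Inter>n. F t n) \<subseteq> A t"
    proof
      fix x assume x: "x \<in> (\<Inter>n. F t n)"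
      show "x \<in> A t" unfolding A_def
      proof safe
        fix s assume s: "s \<le> t - T0"
        \<comment> \<open>This \<open>n\<close> puts the start time of \<open>F t n\<close> at least
          \<open>T0\<close> before \<open>s\<close>, as \<open>shrink\<close> requires.\<close>
        obtain n where "real n > (t - s) / T0" using reals_Archimedean2 by blast
        then have "t - real (Suc n) * T0 \<le> s - T0" using T0 by (simp add: field_simps)
        then show "x \<in> S t s ` B" using shrink[of "t - real (Suc n) * T0" s t] x s T0
          by (auto simp: F_def)
      qed
    qed
  qed
  have compA: "compact (A t)" for t
    unfolding A_F using compF by (intro compact_Inter) auto
  have AB: "A t \<subseteq> B" for t
    using inB[of _ "t - T0" t] by (auto simp: A_def)
  have inv: "S t s ` A s = A t" if st: "s \<le> t" for t s
  proof
    show "S t s ` A s \<subseteq> A t"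
    proof -
      have "S t s y \<in> S t u ` B" if y: "y \<in> A s" and u: "u \<le> t - T0" for y u
      proof -
        \<comment> \<open>\<open>s'\<close> precedes \<open>s\<close> by \<open>T0\<close>, so that
          \<open>y\<close> is reached from \<open>B\<close> at time \<open>s'\<close>, and also
          precedes \<open>u\<close> by \<open>T0\<close>, so that \<open>shrink\<close>
          applies.\<close>
        define s' where "s' = min s u - T0"
        have s': "s' \<le> s - T0" "s' \<le> u - T0" by (auto simp: s'_def)
        then obtain b where b: "b \<in> B" "y = S s s' b" using y by (auto simp: A_def)
        have "S t s y = S t s' b" using b cocycle[of s' s t b] s' st T0 by simp
        also have "\<dots> \<in> S t u ` B" using shrink[OF s'(2), of t] b u T0 by auto
        finally show ?thesis .
      qed
      then show ?thesis by (auto simp: A_def)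
    qed
    show "A t \<subseteq> S t s ` A s"
    proof
      fix x assume x: "x \<in> A t"
      \<comment> \<open>A common point of the nested compact sets \<open>G n\<close> is a preimage
        of \<open>x\<close> lying in \<open>A s\<close>.\<close>
      define G where "G n = F s n \<inter> S t s -` {x}" for n
      have "(\<Inter>n. G n) \<noteq> {}"
      proof (rule compact_nest)
        show "compact (G n)" for n
          unfolding G_def by (intro compact_Int_closed compF closed_vimage cont st) auto
        show "G n \<noteq> {}" for n
        proof -
          \<comment> \<open>The orbit reaching \<open>x\<close> is started \<open>T0\<close> before
            \<open>s'\<close>, so it lies in \<open>B\<close> at time \<open>s'\<close> and in
            \<open>F s n\<close> at time \<open>s\<close>.\<close>
          define s' where "s' = s - real (Suc n) * T0"
          have s': "s' \<le> s" "s' - T0 \<le> t - T0" using lt[of s n] st by (auto simp: s'_def)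
          then have "x \<in> S t (s' - T0) ` B" using x by (auto simp: A_def)
          then obtain b where b: "b \<in> B" "x = S t (s' - T0) b" by blast
          then have "x = S t s (S s s' (S s' (s' - T0) b))"
            using cocycle[of "s' - T0" s' s b] cocycle[of "s' - T0" s t b] s' st T0 by simp
          then have "S s s' (S s' (s' - T0) b) \<in> G n"
            using inB[OF b(1), of "s' - T0" s'] by (auto simp: G_def F_def s'_def)
          then show ?thesis by blast
        qed
        show "m \<le> n \<Longrightarrow> G n \<subseteq> G m" for m n using decF[of m n s] by (auto simp: G_def)
      qed
      then show "x \<in> S t s ` A s" by (auto simp: A_F G_def)
    qed
  qed
  have attr: "pullback_attracts S A"
    unfolding pullback_attracts_def
  proof (intro allI impI)
    fix D :: "'a set" and t e :: real
    assume D: "bounded D" and e: "e > 0"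
    define N where "N = (\<Union>z\<in>A t. ball z e)"
    \<comment> \<open>Otherwise the nested compact sets \<open>F t n - N\<close> are nonempty, and a
      common point lies in \<open>A t\<close> but outside its neighbourhood
      \<open>N\<close>.\<close>
    have "\<exists>n. F t n \<subseteq> N"
    proof (rule ccontr)
      assume "\<not> ?thesis"
      then have nonempty: "F t n - N \<noteq> {}" for n by blast
      have "open N" by (auto simp: N_def)
      then have "(\<Inter>n. F t n - N) \<noteq> {}"
        by (intro compact_nest compact_diff compF nonempty Diff_mono decF) auto
      then obtain x where "x \<in> A t" "x \<notin> N" by (auto simp: A_F)
      then show False using e by (auto simp: N_def)
    qed
    then obtain n where n: "F t n \<subseteq> N" by blast
    obtain T where T: "T > 0" "\<And>t s. s \<ge> T \<Longrightarrow> S t (t - s) ` D \<subseteq> B" using absorb[OF D] by blast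
    define u where "u = t - real (Suc n) * T0"
    \<comment> \<open>Such an orbit is in \<open>B\<close> at time \<open>u\<close>, hence in
      \<open>F t n\<close> at time \<open>t\<close>.\<close>
    have "\<forall>y\<in>S t s ` D. \<exists>z\<in>A t. dist y z < e" if s: "s \<le> u - T" for s
    proof clarify
      fix x assume x: "x \<in> D"
      have "S u s x \<in> B" using T(2)[of "u - s" u] s x by auto
      moreover have "S t s x = S t u (S u s x)" using cocycle[of s u t x] s T lt[of t n] by (simp add: u_def)
      ultimately have "S t s x \<in> F t n" by (auto simp: F_def u_def)
      with n have "S t s x \<in> N" by blast
      then show "\<exists>z\<in>A t. dist (S t s x) z < e" by (auto simp: N_def dist_commute)
    qed
    then show "eventually (\<lambda>s. \<forall>y\<in>S t s ` D. \<exists>z\<in>A t. dist y z < e) at_bot"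
      unfolding eventually_at_bot_linorder by blast
  qed
  have minimal: "A t \<subseteq> C t" if C: "\<forall>t. closed (C t)" "pullback_attracts S C" for C t
  proof
    fix x assume x: "x \<in> A t"
    have "\<exists>z\<in>C t. dist z x < e" if e: "e > 0" for e
    proof -
      have "eventually (\<lambda>s. \<forall>y\<in>S t s ` B. \<exists>z\<in>C t. dist y z < e) at_bot"
        using C(2) compact_imp_bounded[OF B] e unfolding pullback_attracts_def by blast
      then obtain N where N: "\<And>s. s \<le> N \<Longrightarrow> \<forall>y\<in>S t s ` B. \<exists>z\<in>C t. dist y z < e"
        unfolding eventually_at_bot_linorder by blast
      \<comment> \<open>Early enough for \<open>C\<close> to attract \<open>B\<close> up to
        \<open>e\<close>, and not after \<open>t\<close>, so that invariance writes \<open>x\<close>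
        as the image of a point of \<open>A s \<subseteq> B\<close>.\<close>
      define s where "s = min N t"
      have "x \<in> S t s ` B" using inv[of s t] x AB[of s] by (auto simp: s_def)
      then show ?thesis using N[of s] by (auto simp: s_def dist_commute)
    qed
    then have "x \<in> closure (C t)" by (auto simp: closure_approachable)
    then show "x \<in> C t" using C(1) by simp
  qed
  have "pullback_attractor S A"
    unfolding pullback_attractor_def using minimal by (intro conjI allI impI compA inv attr) simp_all
  moreover have "bounded (\<Union>t. A t)"
    using bounded_subset[OF compact_imp_bounded[OF B]] AB by blast
  ultimately show ?thesis by blast
qed


section \<open>The process of a dissipative equation\<close>

lemma is_solution_iff_primitive:
  "is_solution f r T x0 x \<longleftrightarrow> r \<le> T \<and> x r = x0 \<and> primitive_on r T x (\<lambda>s. f s (x s))"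
proof
  assume sol: "is_solution f r T x0 x"
  then have rT: "r \<le> T" and i: "set_integrable lborel {r..T} (\<lambda>s. f s (x s))"
    by (auto simp: is_solution_def)
  have eq: "x t = x0 + (LINT s:{r..t}|lborel. f s (x s))" if "t \<in> {r..T}" for t
    using sol that by (auto simp: is_solution_def)
  have x0: "x r = x0"
    using eq[of r] rT set_borel_integral_eq_integral(2)[OF set_integrable_subinterval[OF i, of r r]] by simp
  have "primitive_on r T x (\<lambda>s. f s (x s))"
    unfolding primitive_on_def x0 using i eq by blast
  with rT x0 show "r \<le> T \<and> x r = x0 \<and> primitive_on r T x (\<lambda>s. f s (x s))" by blast
next
  assume a: "r \<le> T \<and> x r = x0 \<and> primitive_on r T x (\<lambda>s. f s (x s))"
  then have p: "primitive_on r T x (\<lambda>s. f s (x s))" by blast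
  show "is_solution f r T x0 x"
    unfolding is_solution_def
  proof (intro conjI ballI)
    show "r \<le> T" using a by blast
    show "continuous_on {r..T} x" by (rule primitive_on_continuous[OF p])
    fix t assume t: "t \<in> {r..T}"
    show "set_integrable lborel {r..t} (\<lambda>s. f s (x s))"
      by (rule set_integrable_subinterval[OF primitive_on_integrable[OF p]]) (use t in auto)
    show "x t = x0 + (LINT s:{r..t}|lborel. f s (x s))"
      using primitive_on_eq[OF p, of t] t a by simp
  qed
qed

section \<open>Energy estimates\<close>

lemma primitive_on_minus:
  assumes F: "primitive_on a b F f" and G: "primitive_on a b G g"
  shows "primitive_on a b (\<lambda>t. F t - G t) (\<lambda>t. f t - g t)"
  unfolding primitive_on_def
proof safe
  note iF = primitive_on_integrable[OF F] and iG = primitive_on_integrable[OF G]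
  show "set_integrable lborel {a..b} (\<lambda>t. f t - g t)" by (rule set_integral_diff(1)[OF iF iG])
  fix t assume t: "t \<in> {a..b}"
  have "set_integrable lborel {a..t} f" "set_integrable lborel {a..t} g"
    using set_integrable_subinterval[OF iF, of a t] set_integrable_subinterval[OF iG, of a t] t by auto
  then show "F t - G t = F a - G a + (LINT s:{a..t}|lborel. f s - g s)"
    using primitive_on_eq[OF F, of t] primitive_on_eq[OF G, of t] t by (simp add: set_integral_diff(2))
qed

text \<open>The product rule gives \<open>(norm (x t))\<^sup>2\<close> the density
  \<open>2 * (h t \<bullet> x t)\<close>, to which Gronwall applies. Leaving \<open>h\<close>
  arbitrary also covers the truncated equation and differences of two solutions.\<close>

lemma energy_estimate:
  fixes x h :: "real \<Rightarrow> 'a::euclidean_space"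
  assumes rT: "r \<le> T" and x: "primitive_on r T x h"
    and \<alpha>: "set_integrable lborel {r..T} \<alpha>" and \<beta>: "set_integrable lborel {r..T} \<beta>" "\<And>t. 0 \<le> \<beta> t"
    and ineq: "AE t in lborel. t \<in> {r..T} \<longrightarrow> 2 * (h t \<bullet> x t) \<le> \<alpha> t * (norm (x t))\<^sup>2 + \<beta> t"
    and K: "\<And>u. u \<in> {r..T} \<Longrightarrow> exp (LINT s:{u..T}|lborel. \<alpha> s) \<le> K"
  shows "(norm (x T))\<^sup>2 \<le> exp (LINT s:{r..T}|lborel. \<alpha> s) * (norm (x r))\<^sup>2 + K * (LINT s:{r..T}|lborel. \<beta> s)"
proof -
  have "primitive_on r T (\<lambda>t. (norm (x t))\<^sup>2) (\<lambda>t. 2 * (h t \<bullet> x t))"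
    using primitive_on_inner[OF x x] by (simp add: power2_norm_eq_inner)
  from gronwall_primitive[OF rT this \<alpha> \<beta> ineq K] show ?thesis .
qed

text \<open>Nonnegative coefficients have smaller integrals over subintervals, so one bound confines
  the whole trajectory to a ball.\<close>

lemma energy_estimate_uniform:
  fixes x h :: "real \<Rightarrow> 'a::euclidean_space"
  assumes x: "primitive_on r T x h" and t: "t \<in> {r..T}"
    and \<alpha>: "set_integrable lborel {r..T} \<alpha>" "\<And>t. 0 \<le> \<alpha> t"
    and \<beta>: "set_integrable lborel {r..T} \<beta>" "\<And>t. 0 \<le> \<beta> t"
    and ineq: "AE t in lborel. t \<in> {r..T} \<longrightarrow> 2 * (h t \<bullet> x t) \<le> \<alpha> t * (norm (x t))\<^sup>2 + \<beta> t"
  shows "(norm (x t))\<^sup>2 \<le> exp (LINT s:{r..T}|lborel. \<alpha> s) * ((norm (x r))\<^sup>2 + (LINT s:{r..T}|lborel. \<beta> s))"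
proof -
  let ?E = "exp (LINT s:{r..T}|lborel. \<alpha> s)"
  have mono: "(LINT s:{u..t}|lborel. \<alpha> s) \<le> (LINT s:{r..T}|lborel. \<alpha> s)" if "u \<in> {r..t}" for u
    using set_lint_nonneg_mono[OF \<alpha>] that t by simp
  have "(norm (x t))\<^sup>2 \<le> exp (LINT s:{r..t}|lborel. \<alpha> s) * (norm (x r))\<^sup>2 + ?E * (LINT s:{r..t}|lborel. \<beta> s)"
  proof (rule energy_estimate)
    show "r \<le> t" using t by simp
    show "primitive_on r t x h" using primitive_on_subinterval[OF x] t by simp
    show "set_integrable lborel {r..t} \<alpha>" "set_integrable lborel {r..t} \<beta>"
      using set_integrable_subinterval[OF \<alpha>(1), of r t] set_integrable_subinterval[OF \<beta>(1), of r t] t by auto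
    show "AE s in lborel. s \<in> {r..t} \<longrightarrow> 2 * (h s \<bullet> x s) \<le> \<alpha> s * (norm (x s))\<^sup>2 + \<beta> s"
      using ineq by eventually_elim (use t in auto)
  qed (use \<beta> mono in auto)
  also have "\<dots> \<le> ?E * (norm (x r))\<^sup>2 + ?E * (LINT s:{r..T}|lborel. \<beta> s)"
    using mono[of r] t set_lint_nonneg_mono[OF \<beta>, of r t] by (intro add_mono mult_right_mono mult_left_mono) auto
  finally show ?thesis by (simp add: algebra_simps)
qed

section \<open>Consequences of LC and (H1) for almost every time\<close>

lemma LC_measurable: "LC f \<Longrightarrow> (\<lambda>p. f (fst p) (snd p)) \<in> borel_measurable borel"
  unfolding LC_def by blast

lemma LC_bounds:
  assumes "LC f" "compact K"
  obtains m l where "loc_integrable m" "loc_integrable l"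
    "AE t in lborel. \<forall>x\<in>K. \<forall>y\<in>K. norm (f t x) \<le> m t \<and> norm (f t x - f t y) \<le> l t * dist x y"
  using assms unfolding LC_def by blast

text \<open>Each ball of integer radius has its own exceptional null set; their countable union is
  null, and continuity is local.\<close>

lemma LC_AE_continuous:
  fixes f :: "real \<Rightarrow> real^'n \<Rightarrow> real^'n"
  assumes "LC f"
  shows "AE t in lborel. continuous_on UNIV (f t)"
proof -
  have "\<forall>n. \<exists>l. AE t in lborel. \<forall>x\<in>cball 0 (real n). \<forall>y\<in>cball 0 (real n). norm (f t x - f t y) \<le> l t * dist x y"
  proof
    fix n
    obtain m l where "AE t in lborel. \<forall>x\<in>cball 0 (real n). \<forall>y\<in>cball 0 (real n).
        norm (f t x) \<le> m t \<and> norm (f t x - f t y) \<le> l t * dist x y"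
      using LC_bounds[OF assms compact_cball] .
    then have "AE t in lborel. \<forall>x\<in>cball 0 (real n). \<forall>y\<in>cball 0 (real n). norm (f t x - f t y) \<le> l t * dist x y"
      by eventually_elim blast
    then show "\<exists>l. AE t in lborel. \<forall>x\<in>cball 0 (real n). \<forall>y\<in>cball 0 (real n). norm (f t x - f t y) \<le> l t * dist x y"
      by (rule exI[of _ l])
  qed
  from choice[OF this] obtain l where
    "\<forall>n. AE t in lborel. \<forall>x\<in>cball 0 (real n). \<forall>y\<in>cball 0 (real n). norm (f t x - f t y) \<le> l n t * dist x y"
    by (elim exE)
  then have "AE t in lborel. \<forall>n. \<forall>x\<in>cball 0 (real n). \<forall>y\<in>cball 0 (real n). norm (f t x - f t y) \<le> l n t * dist x y"
    by (subst AE_all_countable)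
  then show ?thesis
  proof eventually_elim
    case (elim t)
    have "isCont (f t) x" for x
    proof -
      obtain n :: nat where n: "norm x < real n" using reals_Archimedean2 by blast
      \<comment> \<open>The absolute value supplies the nonnegative constant that
        \<open>lipschitz_on\<close> demands.\<close>
      have "\<bar>l n t\<bar>-lipschitz_on (ball 0 (real n)) (f t)"
      proof (rule lipschitz_onI)
        fix y z :: "real^'n" assume "y \<in> ball 0 (real n)" "z \<in> ball 0 (real n)"
        then have "y \<in> cball 0 (real n)" "z \<in> cball 0 (real n)" by auto
        then have "dist (f t y) (f t z) \<le> l n t * dist y z" using elim unfolding dist_norm by blast
        also have "\<dots> \<le> \<bar>l n t\<bar> * dist y z" by (intro mult_right_mono) auto
        finally show "dist (f t y) (f t z) \<le> \<bar>l n t\<bar> * dist y z" .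
      qed simp
      then have "continuous_on (ball 0 (real n)) (f t)" by (rule lipschitz_on_continuous_on)
      then show ?thesis using n by (simp add: continuous_on_eq_continuous_at)
    qed
    then show ?case by (simp add: continuous_at_imp_continuous_on)
  qed
qed

text \<open>The graph of a trajectory is a null set, so (H1) must hold for all \<open>x\<close>
  before it can be used along one. Fubini gives almost every \<open>x\<close> for almost every
  \<open>t\<close>; by continuity these \<open>x\<close> form a closed set, and a closed set of full
  measure is everything.\<close>

lemma H1_AE_all:
  fixes f :: "real \<Rightarrow> real^'n \<Rightarrow> real^'n"
  assumes "LC f" and "H1 f \<alpha> \<beta>"
  shows "AE t in lborel. \<forall>x. 2 * (f t x \<bullet> x) \<le> \<alpha> t * (norm x)\<^sup>2 + \<beta> t"
proof -
  have "AE p in (lborel \<Otimes>\<^sub>M lborel).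
        2 * (f (fst p) (snd p) \<bullet> snd p) \<le> \<alpha> (fst p) * (norm (snd p))\<^sup>2 + \<beta> (fst p)"
    using assms(2) unfolding H1_def by blast
  from lborel_pair.AE_pair[OF this]
  have "AE t in lborel. AE x in lborel. 2 * (f t x \<bullet> x) \<le> \<alpha> t * (norm x)\<^sup>2 + \<beta> t" by simp
  with LC_AE_continuous[OF assms(1)] show ?thesis
  proof eventually_elim
    case (elim t)
    define C where "C = {x. 2 * (f t x \<bullet> x) \<le> \<alpha> t * (norm x)\<^sup>2 + \<beta> t}"
    have "closed C" unfolding C_def
      by (intro closed_Collect_le continuous_intros elim(1))
    moreover have "AE x in lebesgue. x \<in> C"
      using elim(2) by (auto simp: C_def intro: AE_completion)
    ultimately show ?case
      using mem_closed_if_AE_lebesgue[of C] by (auto simp: C_def)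
  qed
qed

section \<open>Dependence on initial values and uniqueness\<close>

text \<open>By Cauchy-Schwarz the difference satisfies the energy inequality with coefficient
  \<open>2 * \<bar>l\<bar>\<close> and zero forcing.\<close>

lemma solutions_dist_le:
  fixes f :: "real \<Rightarrow> real^'n \<Rightarrow> real^'n"
  assumes x: "is_solution f r T x0 x" and y: "is_solution f r T y0 y"
    and l: "set_integrable lborel {r..T} l"
    and lip: "AE t in lborel. t \<in> {r..T} \<longrightarrow> norm (f t (x t) - f t (y t)) \<le> l t * dist (x t) (y t)"
  shows "(dist (x T) (y T))\<^sup>2 \<le> exp (LINT s:{r..T}|lborel. 2 * \<bar>l s\<bar>) * (dist x0 y0)\<^sup>2"
proof -
  have rT: "r \<le> T" and xr: "x r = x0" "y r = y0"
    and p: "primitive_on r T x (\<lambda>s. f s (x s))" "primitive_on r T y (\<lambda>s. f s (y s))"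
    using x y by (simp_all add: is_solution_iff_primitive)
  have "(norm (x T - y T))\<^sup>2 \<le> exp (LINT s:{r..T}|lborel. 2 * \<bar>l s\<bar>)
      * ((norm (x r - y r))\<^sup>2 + (LINT s:{r..T}|lborel. 0))"
  proof (rule energy_estimate_uniform[OF primitive_on_minus[OF p]])
    show "set_integrable lborel {r..T} (\<lambda>s. 2 * \<bar>l s\<bar>)" using l by (simp add: set_integrable_abs)
    show "set_integrable lborel {r..T} (\<lambda>s. 0 :: real)" by (simp add: set_integrable_def)
    show "AE t in lborel. t \<in> {r..T} \<longrightarrow>
        2 * ((f t (x t) - f t (y t)) \<bullet> (x t - y t)) \<le> 2 * \<bar>l t\<bar> * (norm (x t - y t))\<^sup>2 + 0"
      using lip
    proof eventually_elim
      case (elim t)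
      show ?case
      proof
        assume "t \<in> {r..T}"
        have "(f t (x t) - f t (y t)) \<bullet> (x t - y t) \<le> norm (f t (x t) - f t (y t)) * norm (x t - y t)"
          by (rule norm_cauchy_schwarz)
        also have "\<dots> \<le> (l t * norm (x t - y t)) * norm (x t - y t)"
          using elim \<open>t \<in> {r..T}\<close> by (intro mult_right_mono) (auto simp: dist_norm)
        also have "\<dots> \<le> (\<bar>l t\<bar> * norm (x t - y t)) * norm (x t - y t)"
          by (intro mult_right_mono) auto
        finally show "2 * ((f t (x t) - f t (y t)) \<bullet> (x t - y t)) \<le> 2 * \<bar>l t\<bar> * (norm (x t - y t))\<^sup>2 + 0"
          by (simp add: power2_eq_square)
      qed
    qed
  qed (use rT in auto)
  then show ?thesis by (simp add: xr dist_norm set_lebesgue_integral_def)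
qed

text \<open>Both trajectories lie in one compact set, for which LC provides a common
  \<open>l\<close>; their initial distance is 0.\<close>

lemma solution_unique:
  fixes f :: "real \<Rightarrow> real^'n \<Rightarrow> real^'n"
  assumes f: "LC f" and x: "is_solution f r T x0 x" and y: "is_solution f r T x0 y"
  shows "x T = y T"
proof -
  have "continuous_on {r..T} x" "continuous_on {r..T} y"
    using x y unfolding is_solution_def by blast+
  then have "compact (x ` {r..T} \<union> y ` {r..T})"
    by (intro compact_Un compact_continuous_image) auto
  from LC_bounds[OF f this] obtain m l where l: "loc_integrable l" and
    lip: "AE t in lborel. \<forall>u\<in>x ` {r..T} \<union> y ` {r..T}. \<forall>v\<in>x ` {r..T} \<union> y ` {r..T}.
      norm (f t u) \<le> m t \<and> norm (f t u - f t v) \<le> l t * dist u v" .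
  have "AE t in lborel. t \<in> {r..T} \<longrightarrow> norm (f t (x t) - f t (y t)) \<le> l t * dist (x t) (y t)"
    using lip by eventually_elim blast
  from solutions_dist_le[OF x y _ this] l show ?thesis by (simp add: loc_integrable_def)
qed

text \<open>Uniqueness makes the description in \<open>S_f\<close> well defined, so any solution
  computes the process.\<close>

lemma S_f_eq:
  fixes f :: "real \<Rightarrow> real^'n \<Rightarrow> real^'n"
  assumes "LC f" "is_solution f r t x0 x"
  shows "S_f f t r x0 = x t"
  unfolding S_f_def using assms solution_unique[OF assms(1)] by (intro the_equality) blast+


section \<open>Global existence by truncation\<close>

text \<open>By the reverse triangle inequality no point of the ball is nearer than
  \<open>norm x - R\<close>, and the radial rescaling attains this distance.\<close>

lemma closest_point_cball_0:
  fixes x :: "'a::euclidean_space"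
  assumes "R > 0" "R \<le> norm x"
  shows "closest_point (cball 0 R) x = (R / norm x) *\<^sub>R x"
proof (rule closest_point_unique[symmetric])
  have nx: "norm x > 0" using assms by linarith
  show "(R / norm x) *\<^sub>R x \<in> cball 0 R" using assms nx by simp
  show "\<forall>z\<in>cball 0 R. dist x ((R / norm x) *\<^sub>R x) \<le> dist x z"
  proof
    fix z :: 'a assume "z \<in> cball 0 R"
    then have "norm x - R \<le> norm x - norm z" by simp
    also have "\<dots> \<le> dist x z" unfolding dist_norm by (rule norm_triangle_ineq2)
    finally have le: "norm x - R \<le> dist x z" .
    have "x - (R / norm x) *\<^sub>R x = (1 - R / norm x) *\<^sub>R x" by (simp add: algebra_simps)
    then have "dist x ((R / norm x) *\<^sub>R x) = \<bar>1 - R / norm x\<bar> * norm x" by (simp add: dist_norm)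
    also have "\<dots> = norm x - R" using assms nx by (simp add: field_simps)
    finally show "dist x ((R / norm x) *\<^sub>R x) \<le> dist x z" using le by simp
  qed
qed auto

text \<open>The truncation at radius \<open>R \<ge> 1\<close> satisfies a dissipativity estimate whose coefficients do not
  depend on \<open>R\<close>, so \<open>R\<close> can be chosen larger than the resulting a priori bound.\<close>

lemma truncated_dissipativity:
  fixes v :: "'a::euclidean_space \<Rightarrow> 'a"
  assumes R: "R \<ge> 1" and b: "b \<ge> 0"
    and v: "\<And>x. 2 * (v x \<bullet> x) \<le> a * (norm x)\<^sup>2 + b"
  shows "2 * (v (closest_point (cball 0 R) x) \<bullet> x) \<le> (\<bar>a\<bar> + b) * (norm x)\<^sup>2 + b"
proof (cases "norm x \<le> R")
  case True
  then have "closest_point (cball 0 R) x = x" by (simp add: closest_point_self)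
  then have "2 * (v (closest_point (cball 0 R) x) \<bullet> x) \<le> a * (norm x)\<^sup>2 + b" using v by simp
  also have "\<dots> \<le> (\<bar>a\<bar> + b) * (norm x)\<^sup>2 + b" using b by (intro add_right_mono mult_right_mono) auto
  finally show ?thesis .
next
  case False
  \<comment> \<open>\<open>c\<close> is the stretching factor from the projection \<open>p\<close>
    back to \<open>x\<close>; the hypothesis is used at \<open>p\<close> and multiplied by
    \<open>c\<close>.\<close>
  define c where "c = norm x / R"
  define p where "p = closest_point (cball 0 R) x"
  have p: "p = (R / norm x) *\<^sub>R x" unfolding p_def using False R by (intro closest_point_cball_0) auto
  have c: "c \<ge> 1" "c \<le> norm x" using False R mult_right_mono[of 1 R "norm x"] by (auto simp: c_def field_simps)
  have x0: "x \<noteq> 0" using R False by auto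
  have np: "norm p = R" using p R x0 by simp
  have x: "x = c *\<^sub>R p" using p R x0 by (simp add: c_def)
  have "2 * (v p \<bullet> x) = c * (2 * (v p \<bullet> p))" by (simp add: x)
  also have "\<dots> \<le> c * (a * R\<^sup>2 + b)" using v[of p] c by (intro mult_left_mono) (auto simp: np)
  also have "\<dots> \<le> c * (\<bar>a\<bar> * R\<^sup>2 + b)" using c by (intro mult_left_mono add_right_mono mult_right_mono) auto
  also have "\<dots> = \<bar>a\<bar> * (c * R\<^sup>2) + b * c" by (simp add: algebra_simps)
  \<comment> \<open>Here \<open>1 \<le> R \<le> norm x\<close> gives
    \<open>c * R\<^sup>2 = norm x * R\<close> and \<open>c \<le> norm x\<close>. The term
    \<open>b * c\<close> moves into the quadratic coefficient, which explains
    \<open>\<bar>a\<bar> + b\<close>.\<close>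
  also have "\<dots> \<le> \<bar>a\<bar> * (norm x)\<^sup>2 + b * (norm x)\<^sup>2"
  proof (intro add_mono mult_left_mono)
    have "c * R\<^sup>2 = norm x * R" using R by (simp add: c_def power2_eq_square)
    also have "\<dots> \<le> norm x * norm x" using False by (intro mult_left_mono) auto
    finally show "c * R\<^sup>2 \<le> (norm x)\<^sup>2" by (simp add: power2_eq_square)
    have "c * 1 \<le> norm x * norm x" using c by (intro mult_mono) auto
    then show "c \<le> (norm x)\<^sup>2" by (simp add: power2_eq_square)
  qed (use b in auto)
  finally show ?thesis using b by (simp add: p_def algebra_simps)
qed

text \<open>The solution of the truncated equation never leaves the ball on which truncation changes
  nothing, so it solves the original equation.\<close>

lemma solution_exists:
  fixes f :: "real \<Rightarrow> real^'n \<Rightarrow> real^'n"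
  assumes f: "LC f" and H1: "H1 f \<alpha> \<beta>" and rT: "r \<le> T"
  shows "\<exists>x. is_solution f r T x0 x"
proof -
  have \<alpha>: "set_integrable lborel {r..T} \<alpha>" and \<beta>: "set_integrable lborel {r..T} \<beta>" "\<And>t. 0 \<le> \<beta> t"
    using H1 by (auto simp: H1_def loc_integrable_def)
  define a where "a t = \<bar>\<alpha> t\<bar> + \<beta> t" for t
  have a: "set_integrable lborel {r..T} a" "\<And>t. 0 \<le> a t"
    unfolding a_def[abs_def] using \<alpha> \<beta> by (auto intro!: set_integral_add set_integrable_abs)
  \<comment> \<open>The a priori bound on the squared norm for every truncation radius at least 1;
    \<open>R\<close> can thus be fixed afterwards without circularity.\<close>
  define M where "M = exp (LINT s:{r..T}|lborel. a s) * ((norm x0)\<^sup>2 + (LINT s:{r..T}|lborel. \<beta> s))"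
  define R where "R = max 1 (sqrt M)"
  define P where "P = closest_point (cball (0::real^'n) R)"
  define g where "g t x = f t (P x)" for t x
  have R: "R \<ge> 1" by (simp add: R_def)
  have ball: "convex (cball (0::real^'n) R)" "closed (cball (0::real^'n) R)" "cball (0::real^'n) R \<noteq> {}"
    using R by auto
  have P_in: "P x \<in> cball 0 R" for x unfolding P_def using ball by (intro closest_point_in_set)
  \<comment> \<open>The projection does not increase distances, so the bounds of \<open>f\<close> on
    the ball become global bounds for \<open>g\<close>.\<close>
  have P_lip: "dist (P x) (P y) \<le> dist x y" for x y unfolding P_def using ball by (rule closest_point_lipschitz)
  have "P \<in> borel_measurable borel"
    unfolding P_def by (intro borel_measurable_continuous_onI continuous_on_closest_point ball)
  then have "(\<lambda>p::real \<times> (real^'n). (fst p, P (snd p))) \<in> borel_measurable borel"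
    by (intro borel_measurable_Pair measurable_compose[of snd borel borel P])
      (auto intro!: borel_measurable_continuous_onI continuous_intros)
  from measurable_compose[OF this LC_measurable[OF f]]
  have g_meas: "(\<lambda>p. g (fst p) (snd p)) \<in> borel_measurable borel" by (simp add: g_def)
  obtain m l where ml: "loc_integrable m" "loc_integrable l" and
    bd: "AE t in lborel. \<forall>x\<in>cball 0 R. \<forall>y\<in>cball 0 R. norm (f t x) \<le> m t \<and> norm (f t x - f t y) \<le> l t * dist x y"
    using LC_bounds[OF f compact_cball] .
  have "AE t in lborel. \<forall>x y. norm (g t x) \<le> m t \<and> norm (g t x - g t y) \<le> \<bar>l t\<bar> * dist x y"
    using bd
  proof eventually_elim
    case (elim t)
    have "norm (g t x - g t y) \<le> \<bar>l t\<bar> * dist x y" for x y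
    proof -
      have "norm (g t x - g t y) \<le> l t * dist (P x) (P y)" using elim P_in unfolding g_def by blast
      also have "\<dots> \<le> \<bar>l t\<bar> * dist x y" using P_lip by (intro mult_mono) auto
      finally show ?thesis .
    qed
    moreover have "norm (g t x) \<le> m t" for x using elim P_in unfolding g_def by blast
    ultimately show ?case by blast
  qed
  from picard_lindeloef_L1[OF rT g_meas _ _ this, of x0] ml
  obtain x where x: "primitive_on r T x (\<lambda>s. g s (x s))" "x r = x0"
    by (auto simp: loc_integrable_def set_integrable_abs)
  have ineq: "AE t in lborel. t \<in> {r..T} \<longrightarrow> 2 * (g t (x t) \<bullet> x t) \<le> a t * (norm (x t))\<^sup>2 + \<beta> t"
    using H1_AE_all[OF f H1]
  proof eventually_elim
    case (elim t)
    then show ?case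
      unfolding g_def a_def P_def using truncated_dissipativity[OF R \<beta>(2), of "f t" "\<alpha> t" t "x t"] by blast
  qed
  have xR: "P (x t) = x t" if t: "t \<in> {r..T}" for t
  proof -
    have "(norm (x t))\<^sup>2 \<le> M"
      using energy_estimate_uniform[OF x(1) t a \<beta> ineq] by (simp add: M_def x)
    then have "norm (x t) \<le> R" using real_le_rsqrt[of "norm (x t)" M] by (simp add: R_def)
    then show ?thesis unfolding P_def by (intro closest_point_self) simp
  qed
  have "primitive_on r T x (\<lambda>s. f s (x s))"
  proof -
    have cong: "set_integrable lborel {r..T} (\<lambda>s. f s (x s))"
      using primitive_on_integrable[OF x(1)]
      by (rule set_integrable_cong[THEN iffD1, rotated 3]) (auto simp: g_def xR)
    have "(LINT s:{r..t}|lborel. g s (x s)) = (LINT s:{r..t}|lborel. f s (x s))" if "t \<in> {r..T}" for t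
      using that by (intro set_lebesgue_integral_cong) (auto simp: g_def xR)
    then show ?thesis
      using x(1) cong unfolding primitive_on_def by metis
  qed
  then show ?thesis using rT x(2) unfolding is_solution_iff_primitive by blast
qed

section \<open>Cocycle property, growth and continuity of the process\<close>

text \<open>One solution on \<open>{s..t}\<close> restricts to solutions on \<open>{s..u}\<close>
  and \<open>{u..t}\<close>, and each restriction computes the process.\<close>

lemma S_f_cocycle:
  fixes f :: "real \<Rightarrow> real^'n \<Rightarrow> real^'n"
  assumes f: "LC f" and H1: "H1 f \<alpha> \<beta>" and "s \<le> u" "u \<le> t"
  shows "S_f f t u (S_f f u s x0) = S_f f t s x0"
proof -
  obtain x where x: "is_solution f s t x0 x" using solution_exists[OF f H1, of s t x0] assms by auto
  then have p: "primitive_on s t x (\<lambda>r. f r (x r))" and xs: "x s = x0" by (simp_all add: is_solution_iff_primitive)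
  have "is_solution f s u x0 x" "is_solution f u t (x u) x"
    using primitive_on_subinterval[OF p] assms xs by (simp_all add: is_solution_iff_primitive)
  then show ?thesis using x S_f_eq[OF f] by simp
qed

lemma S_f_norm_le:
  fixes f :: "real \<Rightarrow> real^'n \<Rightarrow> real^'n"
  assumes f: "LC f" and H1: "H1 f \<alpha> \<beta>" and rt: "r \<le> t"
    and K: "\<And>u. u \<in> {r..t} \<Longrightarrow> exp (LINT s:{u..t}|lborel. \<alpha> s) \<le> K"
  shows "(norm (S_f f t r x0))\<^sup>2 \<le> exp (LINT s:{r..t}|lborel. \<alpha> s) * (norm x0)\<^sup>2 + K * (LINT s:{r..t}|lborel. \<beta> s)"
proof -
  have ab: "set_integrable lborel {r..t} \<alpha>" "set_integrable lborel {r..t} \<beta>" "\<And>t. 0 \<le> \<beta> t"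
    using H1 by (auto simp: H1_def loc_integrable_def)
  obtain x where x: "is_solution f r t x0 x" using solution_exists[OF f H1 rt] by blast
  then have p: "primitive_on r t x (\<lambda>r. f r (x r))" and xr: "x r = x0" by (simp_all add: is_solution_iff_primitive)
  have "AE s in lborel. s \<in> {r..t} \<longrightarrow> 2 * (f s (x s) \<bullet> x s) \<le> \<alpha> s * (norm (x s))\<^sup>2 + \<beta> s"
    using H1_AE_all[OF f H1] by eventually_elim blast
  from energy_estimate[OF rt p ab this K] show ?thesis by (simp add: xr S_f_eq[OF f x])
qed

text \<open>Solutions starting in a ball around 0 stay in a common larger ball, so a single
  \<open>l\<close> serves them all and the process is locally Lipschitz.\<close>

lemma S_f_continuous:
  fixes f :: "real \<Rightarrow> real^'n \<Rightarrow> real^'n"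
  assumes f: "LC f" and H1: "H1 f \<alpha> \<beta>" and rt: "r \<le> t"
  shows "continuous_on UNIV (S_f f t r)"
proof -
  have \<alpha>: "set_integrable lborel {r..t} (\<lambda>s. \<bar>\<alpha> s\<bar>)" and \<beta>: "set_integrable lborel {r..t} \<beta>" "\<And>t. 0 \<le> \<beta> t"
    using H1 by (auto simp: H1_def loc_integrable_def set_integrable_abs)
  \<comment> \<open>The uniform energy estimate asks for a nonnegative coefficient, hence
    \<open>\<bar>\<alpha> s\<bar>\<close>.\<close>
  have ineq: "AE s in lborel. \<forall>x. 2 * (f s x \<bullet> x) \<le> \<bar>\<alpha> s\<bar> * (norm x)\<^sup>2 + \<beta> s"
    using H1_AE_all[OF f H1]
  proof eventually_elim
    case (elim s)
    have "\<alpha> s * (norm x)\<^sup>2 \<le> \<bar>\<alpha> s\<bar> * (norm x)\<^sup>2" for x :: "real^'n" by (intro mult_right_mono) auto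
    then show ?case using elim by (meson add_right_mono order_trans)
  qed
  have "isCont (S_f f t r) z" for z
  proof -
    define \<rho> where "\<rho> = norm z + 1"
    define M where "M = exp (LINT s:{r..t}|lborel. \<bar>\<alpha> s\<bar>) * (\<rho>\<^sup>2 + (LINT s:{r..t}|lborel. \<beta> s))"
    have bound: "x s \<in> cball 0 (sqrt M)" if x: "is_solution f r t x0 x" and x0: "norm x0 < \<rho>" and s: "s \<in> {r..t}" for x x0 s
    proof -
      have p: "primitive_on r t x (\<lambda>r. f r (x r))" and xr: "x r = x0" using x by (simp_all add: is_solution_iff_primitive)
      have "AE s in lborel. s \<in> {r..t} \<longrightarrow> 2 * (f s (x s) \<bullet> x s) \<le> \<bar>\<alpha> s\<bar> * (norm (x s))\<^sup>2 + \<beta> s"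
        using ineq by eventually_elim blast
      from energy_estimate_uniform[OF p s \<alpha> _ \<beta> this]
      have "(norm (x s))\<^sup>2 \<le> exp (LINT s:{r..t}|lborel. \<bar>\<alpha> s\<bar>) * ((norm x0)\<^sup>2 + (LINT s:{r..t}|lborel. \<beta> s))"
        by (simp add: xr)
      also have "\<dots> \<le> M" unfolding M_def using x0 by (intro mult_left_mono add_right_mono power_mono) auto
      finally show ?thesis by (simp add: real_le_rsqrt)
    qed
    obtain m l where l: "loc_integrable l" and
      lip: "AE t in lborel. \<forall>x\<in>cball 0 (sqrt M). \<forall>y\<in>cball 0 (sqrt M).
        norm (f t x) \<le> m t \<and> norm (f t x - f t y) \<le> l t * dist x y"
      using LC_bounds[OF f compact_cball] .
    have li: "set_integrable lborel {r..t} l" using l by (simp add: loc_integrable_def)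
    define C where "C = exp (LINT s:{r..t}|lborel. 2 * \<bar>l s\<bar>)"
    have "(sqrt C)-lipschitz_on (ball 0 \<rho>) (S_f f t r)"
    proof (rule lipschitz_onI)
      fix x0 y0 :: "real^'n" assume "x0 \<in> ball 0 \<rho>" "y0 \<in> ball 0 \<rho>"
      then have n: "norm x0 < \<rho>" "norm y0 < \<rho>" by auto
      obtain x y where x: "is_solution f r t x0 x" and y: "is_solution f r t y0 y"
        using solution_exists[OF f H1 rt] by metis
      have "AE s in lborel. s \<in> {r..t} \<longrightarrow> norm (f s (x s) - f s (y s)) \<le> l s * dist (x s) (y s)"
        using lip by eventually_elim (use bound[OF x n(1)] bound[OF y n(2)] in blast)
      from solutions_dist_le[OF x y li this]
      have "(dist (x t) (y t))\<^sup>2 \<le> (sqrt C * dist x0 y0)\<^sup>2"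
        by (simp add: C_def power_mult_distrib)
      then have "dist (x t) (y t) \<le> sqrt C * dist x0 y0"
        by (rule power2_le_imp_le) (simp add: C_def)
      then show "dist (S_f f t r x0) (S_f f t r y0) \<le> sqrt C * dist x0 y0"
        by (simp add: S_f_eq[OF f x] S_f_eq[OF f y])
    qed (simp add: C_def)
    then have "continuous_on (ball 0 \<rho>) (S_f f t r)" by (rule lipschitz_on_continuous_on)
    then show ?thesis by (simp add: continuous_on_eq_continuous_at \<rho>_def)
  qed
  then show ?thesis by (simp add: continuous_at_imp_continuous_on)
qed


section \<open>The absorbing ball\<close>

text \<open>The window \<open>{s..s + \<tau>}\<close> is the one of (H3) with centre
  \<open>s + \<tau>/2\<close> and half-length \<open>\<tau>/2\<close>.\<close>

lemma H3_uniform_bound: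
  assumes "H3 \<beta>" "\<tau> > 0"
  obtains C where "\<And>s. (LINT u:{s..s + \<tau>}|lborel. \<beta> u) \<le> C"
proof -
  obtain C where C: "\<And>t. (LINT s:{- (\<tau>/2)..\<tau>/2}|lborel. \<beta> (s + t)) \<le> C"
    using assms unfolding H3_def by (meson half_gt_zero)
  have "(LINT u:{s..s + \<tau>}|lborel. \<beta> u) \<le> C" for s
  proof -
    have "(LINT u|lborel. indicator {s..s + \<tau>} u *\<^sub>R \<beta> u)
        = (LINT u|lborel. indicator {s..s + \<tau>} (s + \<tau>/2 + u) *\<^sub>R \<beta> (s + \<tau>/2 + u))"
      using lborel_integral_real_affine[of 1 "\<lambda>u. indicator {s..s + \<tau>} u *\<^sub>R \<beta> u" "s + \<tau>/2"] by simp
    also have "\<dots> = (LINT u|lborel. indicator {- (\<tau>/2)..\<tau>/2} u *\<^sub>R \<beta> (u + (s + \<tau>/2)))"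
      by (intro Bochner_Integration.integral_cong refl) (auto simp: indicator_def field_simps)
    finally show ?thesis using C[of "s + \<tau>/2"] by (simp add: set_lebesgue_integral_def)
  qed
  then show ?thesis using that by blast
qed

lemma S_f_refl:
  fixes f :: "real \<Rightarrow> real^'n \<Rightarrow> real^'n"
  assumes f: "LC f" and H1: "H1 f \<alpha> \<beta>"
  shows "S_f f t t x = x"
proof -
  obtain y where y: "is_solution f t t x y" using solution_exists[OF f H1 order.refl] by blast
  then show ?thesis using S_f_eq[OF f y] by (simp add: is_solution_iff_primitive)
qed

lemma S_f_absorbing_ball:
  fixes f :: "real \<Rightarrow> real^'n \<Rightarrow> real^'n"
  assumes f: "LC f" and H1: "H1 f \<alpha> \<beta>" and H3: "H3 \<beta>" and H2: "H2_bullet \<alpha>"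
  shows "\<exists>\<rho>. \<forall>D. bounded D \<longrightarrow> (\<exists>T>0. \<forall>t s. s \<ge> T \<longrightarrow> S_f f t (t - s) ` D \<subseteq> cball 0 \<rho>)"
proof -
  obtain \<alpha>1 K where \<alpha>1: "\<alpha>1 > 0" and K: "K \<ge> 1" and
    decay: "\<And>s t. s \<le> t \<Longrightarrow> exp (LINT u:{s..t}|lborel. \<alpha> u) \<le> K * exp (- \<alpha>1 * (t - s))"
    using H2 unfolding H2_bullet_def by blast
  \<comment> \<open>Solves \<open>K * exp (- \<alpha>1 * \<tau>) = 1/2\<close>; it is positive
    because \<open>2 * K > 1\<close>.\<close>
  define \<tau> where "\<tau> = ln (2 * K) / \<alpha>1"
  have \<tau>: "\<tau> > 0" using K \<alpha>1 by (simp add: \<tau>_def)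
  have half: "K * exp (- \<alpha>1 * \<tau>) = 1/2"
    using K \<alpha>1 by (simp add: \<tau>_def exp_minus field_simps)
  obtain C where C: "\<And>s. (LINT u:{s..s + \<tau>}|lborel. \<beta> u) \<le> C" using H3_uniform_bound[OF H3 \<tau>] by blast
  have \<beta>: "loc_integrable \<beta>" "\<And>t. 0 \<le> \<beta> t" using H1 by (auto simp: H1_def)
  have C0: "C \<ge> 0" using order_trans[OF set_lint_nonneg[OF \<beta>(2)] C] .
  \<comment> \<open>Over at most one time step the forcing fits into a single window, so it
    contributes at most \<open>K * C\<close>.\<close>
  have short: "(norm (S_f f t s x))\<^sup>2 \<le> K * exp (- \<alpha>1 * (t - s)) * (norm x)\<^sup>2 + K * C"
    if "s \<le> t" "t \<le> s + \<tau>" for s t x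
  proof -
    have "(norm (S_f f t s x))\<^sup>2 \<le> exp (LINT u:{s..t}|lborel. \<alpha> u) * (norm x)\<^sup>2 + K * (LINT u:{s..t}|lborel. \<beta> u)"
    proof (rule S_f_norm_le[OF f H1 that(1)])
      fix u assume u: "u \<in> {s..t}"
      have "exp (LINT s:{u..t}|lborel. \<alpha> s) \<le> K * exp (- \<alpha>1 * (t - u))" using decay u by simp
      also have "\<dots> \<le> K * 1" using u \<alpha>1 K by (intro mult_left_mono) auto
      finally show "exp (LINT s:{u..t}|lborel. \<alpha> s) \<le> K" by simp
    qed
    also have "\<dots> \<le> K * exp (- \<alpha>1 * (t - s)) * (norm x)\<^sup>2 + K * C"
    proof (intro add_mono mult_right_mono mult_left_mono decay that)
      have "(LINT u:{s..t}|lborel. \<beta> u) \<le> (LINT u:{s..s + \<tau>}|lborel. \<beta> u)"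
        using \<beta> that by (intro set_lint_nonneg_mono) (auto simp: loc_integrable_def)
      then show "(LINT u:{s..t}|lborel. \<beta> u) \<le> C" using C[of s] by linarith
    qed (use K in auto)
    finally show ?thesis .
  qed
  \<comment> \<open>The constant \<open>2 * K * C\<close> is the fixed point of
    \<open>q \<mapsto> q / 2 + K * C\<close>, the effect of one step.\<close>
  have iter: "(norm (S_f f (s + real n * \<tau>) s x))\<^sup>2 \<le> (norm x)\<^sup>2 / 2 ^ n + 2 * K * C" for n s x
  proof (induction n)
    case 0
    show ?case using K C0 by (simp add: S_f_refl[OF f H1])
  next
    case (Suc n)
    define u where "u = s + real n * \<tau>"
    have su: "s \<le> u" "s + real (Suc n) * \<tau> = u + \<tau>" using \<tau> by (simp_all add: u_def algebra_simps)
    have "S_f f (u + \<tau>) s x = S_f f (u + \<tau>) u (S_f f u s x)"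
      using S_f_cocycle[OF f H1 su(1), of "u + \<tau>" x] \<tau> by simp
    then have "(norm (S_f f (u + \<tau>) s x))\<^sup>2 \<le> K * exp (- \<alpha>1 * \<tau>) * (norm (S_f f u s x))\<^sup>2 + K * C"
      using short[of u "u + \<tau>" "S_f f u s x"] \<tau> by simp
    also have "\<dots> = (1/2) * (norm (S_f f u s x))\<^sup>2 + K * C" unfolding half ..
    also have "\<dots> \<le> (1/2) * ((norm x)\<^sup>2 / 2 ^ n + 2 * K * C) + K * C"
      using Suc by (intro add_right_mono mult_left_mono) (auto simp: u_def)
    also have "\<dots> = (norm x)\<^sup>2 / 2 ^ Suc n + 2 * K * C" by (simp add: field_simps)
    finally show ?case unfolding su(2) .
  qed
  \<comment> \<open>Whole steps bring the squared norm below \<open>1 + 2 * K * C\<close>; the last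
    partial step costs a factor \<open>K\<close> and adds \<open>K * C\<close>. Nothing here depends
    on \<open>D\<close>.\<close>
  define M where "M = K * (1 + 2 * K * C) + K * C"
  show ?thesis
  proof (rule exI[of _ "sqrt M"], intro allI impI)
    fix D :: "(real^'n) set" assume "bounded D"
    then obtain d where d: "\<And>x. x \<in> D \<Longrightarrow> norm x \<le> d" by (auto simp: bounded_iff)
    \<comment> \<open>After \<open>n\<close> halvings the initial value contributes at most
      1.\<close>
    obtain n where n: "d\<^sup>2 < 2 ^ n" using real_arch_pow[of 2 "d\<^sup>2"] by auto
    have "S_f f t (t - s) x \<in> cball 0 (sqrt M)" if s: "s \<ge> (real n + 1) * \<tau>" and x: "x \<in> D" for t s x
    proof -
      \<comment> \<open>The number of whole steps fitting into \<open>s\<close>; it is at least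
        \<open>n\<close>, and the remaining time from \<open>u\<close> to \<open>t\<close> is at
        most \<open>\<tau>\<close>.\<close>
      define m where "m = nat \<lfloor>s / \<tau>\<rfloor>"
      have "real n + 1 \<le> s / \<tau>" using s \<tau> by (simp add: field_simps)
      then have m: "real m \<le> s / \<tau>" "s / \<tau> \<le> real m + 1" "n \<le> m"
        unfolding m_def by linarith+
      define u where "u = t - s + real m * \<tau>"
      have u: "t - s \<le> u" "u \<le> t" "t \<le> u + \<tau>" using m \<tau> by (auto simp: u_def field_simps)
      have "(norm x)\<^sup>2 \<le> d\<^sup>2" using d[OF x] by (intro power_mono) auto
      also have "\<dots> \<le> 2 ^ n" using n by simp
      also have "\<dots> \<le> 2 ^ m" using m by (intro power_increasing) auto
      finally have "(norm (S_f f u (t - s) x))\<^sup>2 \<le> 1 + 2 * K * C"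
        using iter[of "t - s" m x] unfolding u_def
        by (smt (verit, best) divide_le_eq_1_pos zero_less_power)
      then have "K * exp (- \<alpha>1 * (t - u)) * (norm (S_f f u (t - s) x))\<^sup>2 \<le> (K * 1) * (1 + 2 * K * C)"
        using K \<alpha>1 u by (intro mult_mono) auto
      then have "(norm (S_f f t u (S_f f u (t - s) x)))\<^sup>2 \<le> M"
        using short[OF u(2,3), of "S_f f u (t - s) x"] by (simp add: M_def)
      then show ?thesis
        using S_f_cocycle[OF f H1 u(1,2)] by (simp add: real_le_rsqrt)
    qed
    moreover have "(real n + 1) * \<tau> > 0" using \<tau> by (intro mult_pos_pos) auto
    ultimately show "\<exists>T>0. \<forall>t s. s \<ge> T \<longrightarrow> S_f f t (t - s) ` D \<subseteq> cball 0 (sqrt M)"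
      by (intro exI[of _ "(real n + 1) * \<tau>"]) blast
  qed
qed

theorem theorem6p7:
  fixes f :: "real \<Rightarrow> real^'n \<Rightarrow> real^'n" and \<alpha> \<beta> :: "real \<Rightarrow> real"
  assumes "LC f" and "H1 f \<alpha> \<beta>" and "H3 \<beta>" and "H2_bullet \<alpha>"
  shows "(\<exists>B. bounded B \<and> (\<forall>D. bounded D \<longrightarrow>
            (\<exists>T>0. \<forall>t s. s \<ge> T \<longrightarrow> S_f f t (t - s) ` D \<subseteq> B)))
       \<and> (\<exists>A. pullback_attractor (S_f f) A \<and> bounded (\<Union>t. A t))"
proof -
  obtain \<rho> where absorb: "\<And>D. bounded D \<Longrightarrow> \<exists>T>0. \<forall>t s. s \<ge> T \<longrightarrow> S_f f t (t - s) ` D \<subseteq> cball 0 \<rho>"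
    using S_f_absorbing_ball[OF assms] by blast
  have "\<exists>A. pullback_attractor (S_f f) A \<and> bounded (\<Union>t. A t)"
    using bounded_pullback_attractor_exists[OF S_f_cocycle[OF assms(1,2)] S_f_continuous[OF assms(1,2)]
        compact_cball absorb] .
  then show ?thesis using absorb bounded_cball by blast
qed

end
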